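(* Fix $\beta_*\in(0,1)$. There exists a constant $C>0$ depending only on $\beta_*$ such that the following holds. Let $(T_n)_{n\ge1}$, $T_n=T_{\alpha_n}$, be an admissible sequence of Pomeau-Manneville maps (i.e. $0<\alpha_n\le\beta_*$ for all $n\ge1$). Let $0\le l<k$ be integers, let $f_0,\ldots,f_l:[0,1]\to\mathbb{R}$ be Lipschitz continuous functions and $f_{l+1},\ldots,f_k\in L^\infty([0,1])$. Fix integers $0=n_0\le n_1\le\dots\le n_k$, and denote $$H=f_0\cdot f_1\circ\widetilde T_{n_1}\cdots f_l\circ\widetilde T_{n_l},\qquad G=f_{l+1}\circ\widetilde T_{n_{l+1}}\cdots f_k\circ\widetilde T_{n_k}.$$ Then, for any probability measure $\mu$ on $[0,1]$ with density $h\in\mathcal{C}_*$ with respect to Lebesgue measure, $$\left|\int HG\,d\mu-\int H\,d\mu\int G\,d\mu\right|\le C\,\prod_{i=0}^l\|f_i\|_{\mathrm{Lip}}\prod_{i=l+1}^k\|f_i\|_\infty\ \rho(n_{l+1}-n_l).$$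
   Context: For $\alpha\in(0,1)$ the Pomeau-Manneville map $T_\alpha:[0,1]\to[0,1]$ is $T_\alpha(x)=x(1+2^\alpha x^\alpha)$ for $x\in[0,1/2)$ and $T_\alpha(x)=2x-1$ for $x\in[1/2,1]$. For a sequence $(T_{\alpha_n})_{n\ge1}$ write $T_n=T_{\alpha_n}$, $\widetilde T_n=T_n\circ\cdots\circ T_1$ for $n\ge1$, and $\widetilde T_0=\mathrm{id}$. With $m$ the Lebesgue measure on $[0,1]$ and $m(f)=\int f\,dm$, the cone $\mathcal{C}_*=\mathcal{C}_*(\beta_* )$ is $$\mathcal{C}_*=\{f\in C((0,1])\cap L^1:\ f\ge0,\ f\text{ decreasing},\ x^{\beta_*+1}f\text{ increasing},\ f(x)\le 2^{\beta_*}(2+\beta_* )x^{-\beta_*}m(f)\},$$ where monotonicity is in the weak sense. For Lipschitz $f:[0,1]\to\mathbb{R}$, $\|f\|_{\mathrm{Lip}}=\|f\|_\infty+\mathrm{Lip}(f)$ with $\mathrm{Lip}(f)=\sup_{x\ne y}|f(x)-f(y)|/|x-y|$. $\rho(0)=\rho(1)=1$ and $\rho(n)=n^{-\frac1{\beta_*}+1}(\log n)^{\frac1{\beta_*}}$ for $n\ge2$. *)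

theory Defs
  imports "HOL-Probability.Probability"
begin

text \<open>Lebesgue measure on the unit interval, with all Lebesgue measurable sets as its sigma-algebra.
  The maps below are non-singular, so composing with them preserves Lebesgue measurability and
  almost everywhere equality.\<close>

abbreviation leb01 :: "real measure" where
  "leb01 \<equiv> lebesgue_on {0..1}"

text \<open>Functions on the unit interval are total functions on the reals whose values outside
  \<open>{0..1}\<close> are irrelevant. At \<open>x = 0\<close> the left branch is \<open>0\<close>.\<close>

definition pm_map :: "real \<Rightarrow> real \<Rightarrow> real" where
  "pm_map a x = (if x < 1/2 then x * (1 + 2 powr a * x powr a) else 2 * x - 1)"

text \<open>The parameter sequence is indexed from \<open>1\<close>; the value \<open>\<alpha> 0\<close> is never used.\<close>

primrec pm_iter :: "(nat \<Rightarrow> real) \<Rightarrow> nat \<Rightarrow> real \<Rightarrow> real" where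
  "pm_iter \<alpha> 0 = id"
| "pm_iter \<alpha> (Suc n) = pm_map (\<alpha> (Suc n)) \<circ> pm_iter \<alpha> n"

definition admissible :: "real \<Rightarrow> (nat \<Rightarrow> real) \<Rightarrow> bool" where
  "admissible \<beta> \<alpha> \<longleftrightarrow> (\<forall>n\<ge>1. 0 < \<alpha> n \<and> \<alpha> n \<le> \<beta>)"

text \<open>Membership in the cone leaves the value at \<open>0\<close> unconstrained.\<close>

definition pm_cone :: "real \<Rightarrow> (real \<Rightarrow> real) set" where
  "pm_cone \<beta> = {f. continuous_on {0<..1} f \<and> integrable leb01 f \<and>
      (\<forall>x\<in>{0<..1}. 0 \<le> f x) \<and>
      antimono_on {0<..1} f \<and>
      mono_on {0<..1} (\<lambda>x. x powr (\<beta> + 1) * f x) \<and>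
      (\<forall>x\<in>{0<..1}. f x \<le> 2 powr \<beta> * (2 + \<beta>) * x powr (- \<beta>) * (\<integral>y. f y \<partial>leb01))}"

text \<open>Essentially bounded functions are represented by functions rather than by classes modulo
  almost everywhere equality.\<close>

definition Linfty :: "(real \<Rightarrow> real) set" where
  "Linfty = {f. f \<in> borel_measurable leb01 \<and> esssup leb01 (\<lambda>x. ereal \<bar>f x\<bar>) < \<infinity>}"

definition norm_infty :: "(real \<Rightarrow> real) \<Rightarrow> real" where
  "norm_infty f = real_of_ereal (esssup leb01 (\<lambda>x. ereal \<bar>f x\<bar>))"

definition is_lipschitz :: "(real \<Rightarrow> real) \<Rightarrow> bool" where
  "is_lipschitz f \<longleftrightarrow> (\<exists>L. L-lipschitz_on {0..1} f)"

definition Lip :: "(real \<Rightarrow> real) \<Rightarrow> real" where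
  "Lip f = Sup {\<bar>f x - f y\<bar> / \<bar>x - y\<bar> | x y. x \<in> {0..1} \<and> y \<in> {0..1} \<and> x \<noteq> y}"

definition norm_Lip :: "(real \<Rightarrow> real) \<Rightarrow> real" where
  "norm_Lip f = norm_infty f + Lip f"

definition rho :: "real \<Rightarrow> nat \<Rightarrow> real" where
  "rho \<beta> n = (if n \<le> 1 then 1 else real n powr (- 1 / \<beta> + 1) * ln (real n) powr (1 / \<beta>))"

end

theory Submission
  imports Defs
begin

text \<open>Write \<open>P\<close> for the transfer operators. Let \<open>x\<^sub>j\<close> be the point that reaches \<open>1\<close> after \<open>j\<close> steps on the
  left branches; \<open>x\<^sub>j\<close> is of order at most \<open>j powr (-1/\<beta>)\<close>. For a nonnegative decreasing \<open>f\<close>, the mass that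
  leaves through the right branch at step \<open>j\<close> has a density of at least a constant times
  \<open>f x\<^sub>j * (x\<^sub>j\<^sub>-\<^sub>1 - x\<^sub>j)\<close>. Summing these lower Riemann sums gives \<open>P^n f \<ge> c * \<integral>f\<close> as soon as \<open>f\<close>
  is constant on \<open>(0, 2 x\<^sub>n)\<close>.

  Two decreasing functions of equal mass are therefore coupled as follows: truncate both at height
  \<open>f \<epsilon>\<close>, which costs mass \<open>O(\<epsilon> powr (1 - \<beta>))\<close> by the cone condition, apply \<open>P^n\<close> with
  \<open>n = O(\<epsilon> powr (-\<beta>))\<close>, and subtract the common constant. The remainders are again nonnegative and
  decreasing, so this can be iterated; \<open>k = O(log N)\<close> rounds with \<open>N = k n\<close> give the rate \<open>\<rho> N\<close>.

  The push-forward of \<open>h H\<close> under the first maps is a sum over inverse branches of a Lipschitz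
  function times a decreasing one, hence a difference of two decreasing functions that are dominated
  by the push-forward of \<open>h\<close>, to which the coupling applies.\<close>

section \<open>The inverse of the left branch\<close>

text \<open>After a common constant is subtracted, a remainder has less mass but may keep its pole
  at 0, so its pole bound relative to its own mass gets worse and membership in the cone may be
  lost. Remainders are therefore only kept below \<open>K * F\<close>, where \<open>F\<close> is a
  density with the pole bound that is moved by the same operators; \<open>K\<close> never changes.
  The price is that the bound for the mass discarded per round, of order
  \<open>K * n powr (1 - 1/\<beta>)\<close>, does not decay. Summed over \<open>k\<close> rounds of
  length \<open>n = N / k\<close> it becomes
  \<open>k powr (1/\<beta>) * N powr (1 - 1/\<beta>)\<close>, and with \<open>k\<close> of order
  \<open>ln N\<close> the first factor is the logarithm in \<open>rho\<close>.

  The constants depend on \<beta> alone because the estimates near the neutral fixed point compare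
  the exponent \<alpha> with \<beta> at a point \<open>2 * y \<le> 1\<close>, where
  \<open>(2 * y) powr \<beta> \<le> (2 * y) powr \<alpha>\<close>; parameters close to 0 do no
  harm.\<close>

definition lbranch :: "real \<Rightarrow> real \<Rightarrow> real" where
  "lbranch a y = y * (1 + 2 powr a * y powr a)"

text \<open>The formula of the left branch is an increasing bijection of the positive half-line.
  Inverting it there, and not only on \<open>(0, 1/2)\<close>, makes the inverse differentiable also
  at 1, where the backward orbits used below start.\<close>

definition linv :: "real \<Rightarrow> real \<Rightarrow> real" where
  "linv a = inv_into {0<..} (lbranch a)"

text \<open>The derivative of \<open>linv a\<close> at \<open>x\<close>, that is, the reciprocal of
  the slope of the left branch at the preimage of \<open>x\<close>; see
  \<open>linv_deriv\<close>.\<close>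

definition lweight :: "real \<Rightarrow> real \<Rightarrow> real" where
  "lweight a x = 1 / (1 + (1 + a) * (2 * linv a x) powr a)"

lemma lbranch_strict_mono:
  assumes "0 \<le> a" "0 < x" "x < y"
  shows "lbranch a x < lbranch a y"
proof -
  have "x powr a \<le> y powr a" using assms by (intro powr_mono2) auto
  then show ?thesis unfolding lbranch_def
    using assms by (intro mult_less_le_imp_less) (auto simp: add_pos_nonneg)
qed

lemma lbranch_deriv:
  assumes "0 < y"
  shows "(lbranch a has_real_derivative 1 + (1 + a) * (2 * y) powr a) (at y)"
proof -
  have "((\<lambda>y. y * (1 + 2 powr a * y powr a)) has_real_derivative
     1 + (1 + a) * (2 * y) powr a) (at y)"
    using assms
    by (auto intro!: derivative_eq_intros simp: powr_mult powr_diff divide_simps algebra_simps)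
  then show ?thesis by (simp add: lbranch_def[abs_def])
qed

lemma lbranch_surj:
  assumes "0 \<le> a" "0 < x"
  shows "\<exists>y>0. lbranch a y = x"
proof -
  let ?d = "1 + 2 powr a * x powr a"
  have d: "?d \<ge> 1" by simp
  \<comment> \<open>The second factor of \<open>lbranch\<close> is increasing, so dividing by its
    value at \<open>x\<close> gives a point that undershoots, while \<open>x\<close> itself
    overshoots; the intermediate value theorem applies between them.\<close>
  define z where "z = x / ?d"
  have d0: "0 < ?d" using d by linarith
  have z: "0 < z" "z \<le> x" using assms d d0 unfolding z_def
    by (auto intro: divide_pos_pos simp: pos_divide_le_eq)
  have "z powr a \<le> x powr a" using z assms by (intro powr_mono2) auto
  then have "lbranch a z \<le> z * ?d" unfolding lbranch_def using z by (intro mult_left_mono) auto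
  also have "\<dots> = x" using d0 unfolding z_def by simp
  finally have 1: "lbranch a z \<le> x" .
  have "x * 1 \<le> x * ?d" using assms d by (intro mult_left_mono) auto
  then have 2: "x \<le> lbranch a x" unfolding lbranch_def by simp
  have "continuous_on {z..x} (lbranch a)"
    using z by (intro DERIV_continuous_on[where D = "\<lambda>y. 1 + (1 + a) * (2 * y) powr a"])
      (auto intro!: has_field_derivative_at_within[OF lbranch_deriv])
  from IVT'[OF 1 2 z(2) this] obtain y where "z \<le> y" "lbranch a y = x" by blast
  then show ?thesis using z(1) by (intro exI[of _ y]) auto
qed

lemma linv:
  assumes "0 \<le> a" "0 < x"
  shows linv_pos: "0 < linv a x" and lbranch_linv: "lbranch a (linv a x) = x"
proof -
  have "x \<in> lbranch a ` {0<..}" using lbranch_surj[OF assms] by auto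
  from inv_into_into[OF this] f_inv_into_f[OF this]
  show "0 < linv a x" "lbranch a (linv a x) = x" by (auto simp: linv_def)
qed

lemma linv_strict_mono:
  assumes "0 \<le> a" "0 < x" "x < y"
  shows "linv a x < linv a y"
proof (rule ccontr)
  assume "\<not> ?thesis"
  then have "linv a y < linv a x \<or> linv a y = linv a x" by auto
  then show False
    using lbranch_strict_mono[of a "linv a y" "linv a x"] linv[of a x] linv[of a y] assms by auto
qed

lemma linv_mono: "0 \<le> a \<Longrightarrow> 0 < x \<Longrightarrow> x \<le> y \<Longrightarrow> linv a x \<le> linv a y"
  using linv_strict_mono[of a x y] by (cases "x = y") auto

lemma lbranch_half: "lbranch a (1/2) = 1"
  by (simp add: lbranch_def powr_mult[symmetric])

lemma linv_1: "0 \<le> a \<Longrightarrow> linv a 1 = 1/2"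
  using lbranch_strict_mono[of a "1/2" "linv a 1"] lbranch_strict_mono[of a "linv a 1" "1/2"]
    linv[of a 1] lbranch_half[of a] by (cases "linv a 1" "1/2 :: real" rule: linorder_cases) auto

lemma linv_le_half: "0 \<le> a \<Longrightarrow> 0 < x \<Longrightarrow> x \<le> 1 \<Longrightarrow> linv a x \<le> 1/2"
  using linv_mono[of a x 1] linv_1 by auto

lemma linv_less_half: "0 \<le> a \<Longrightarrow> 0 < x \<Longrightarrow> x < 1 \<Longrightarrow> linv a x < 1/2"
  using linv_strict_mono[of a x 1] linv_1 by auto

lemma linv_eq:
  assumes "0 \<le> a" "0 < x"
  shows "x = linv a x * (1 + (2 * linv a x) powr a)"
  using linv[OF assms] by (simp add: lbranch_def powr_mult)

lemma linv_ge_half: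
  assumes "0 \<le> a" "0 < x" "x \<le> 1"
  shows "x / 2 \<le> linv a x"
proof -
  have "(2 * linv a x) powr a \<le> 1"
    using assms linv_pos[of a x] linv_le_half[of a x] by (intro powr_le1) auto
  then have "linv a x * (1 + (2 * linv a x) powr a) \<le> linv a x * 2"
    using linv_pos[of a x] assms by (intro mult_left_mono) auto
  then show ?thesis using linv_eq[OF assms(1,2)] by simp
qed

lemma linv_le: "0 \<le> a \<Longrightarrow> 0 < x \<Longrightarrow> linv a x \<le> x"
  using linv_eq[of a x] linv_pos[of a x] by (smt (verit) mult_le_cancel_left1 powr_ge_zero)

lemma lweight_antimono:
  assumes "0 \<le> a" "0 < x" "x \<le> y"
  shows "lweight a y \<le> lweight a x"
  unfolding lweight_def using assms linv_mono[OF assms] linv_pos[of a x]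
  by (intro divide_left_mono add_left_mono mult_left_mono powr_mono2 mult_pos_pos add_pos_nonneg) auto

lemma lweight_bounds:
  assumes "0 \<le> a" "a \<le> 1" "0 < x" "x \<le> 1"
  shows "1/3 \<le> lweight a x" "lweight a x \<le> 1"
proof -
  have "(2 * linv a x) powr a \<le> 1"
    using assms linv_pos[of a x] linv_le_half[of a x] by (intro powr_le1) auto
  then have "(1 + a) * (2 * linv a x) powr a \<le> 2 * 1"
    using assms by (intro mult_mono) auto
  then show "1/3 \<le> lweight a x" "lweight a x \<le> 1"
    unfolding lweight_def using assms by (auto simp: divide_simps add_pos_nonneg)
qed

lemma linv_deriv:
  assumes "0 \<le> a" "0 < x"
  shows "(linv a has_real_derivative lweight a x) (at x)"
proof -
  have "(linv a has_real_derivative inverse (1 + (1 + a) * (2 * linv a x) powr a)) (at x)"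
  proof (rule DERIV_inverse_function[where a = 0 and b = "x + 1" and f = "lbranch a"])
    show "(lbranch a has_real_derivative 1 + (1 + a) * (2 * linv a x) powr a) (at (linv a x))"
      using lbranch_deriv linv_pos assms by auto
    show "1 + (1 + a) * (2 * linv a x) powr a \<noteq> 0"
      using assms by (smt (verit) mult_nonneg_nonneg powr_ge_zero)
    show "0 < x" "x < x + 1" using assms by auto
    show "lbranch a (linv a y) = y" if "0 < y" for y using lbranch_linv that assms by auto
    show "isCont (linv a) x"
    proof -
      let ?l = "linv a x"
      have l: "0 < ?l" using linv_pos assms by auto
      have inj: "inj_on (lbranch a) {0<..}"
        using lbranch_strict_mono assms(1) by (intro linorder_inj_onI) (auto, fastforce)
      \<comment> \<open>The radius \<open>?l / 2\<close> keeps the neighbourhood inside the positive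
        half-line.\<close>
      have "isCont (linv a) (lbranch a ?l)"
      proof (rule isCont_inverse_function[where d = "?l / 2" and f = "lbranch a" and x = ?l])
        show "linv a (lbranch a z) = z" if "\<bar>z - ?l\<bar> \<le> ?l / 2" for z
          unfolding linv_def using that l by (intro inv_into_f_f[OF inj]) (auto simp: abs_if split: if_splits)
        show "isCont (lbranch a) z" if "\<bar>z - ?l\<bar> \<le> ?l / 2" for z
          using that l
          by (intro DERIV_isCont[OF lbranch_deriv]) (auto simp: abs_if split: if_splits)
      qed (use l in auto)
      then show ?thesis using lbranch_linv assms by auto
    qed
  qed
  then show ?thesis by (simp add: lweight_def divide_inverse)
qed

text \<open>The inverse of a convex increasing branch is concave, so the secant slope is at most the
  derivative at the left end.\<close>

lemma linv_diff_le:
  assumes "0 \<le> a" "0 < x" "x \<le> y"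
  shows "linv a y - linv a x \<le> (y - x) * lweight a x"
proof (cases "x = y")
  case False
  then have "\<exists>z>x. z < y \<and> linv a y - linv a x = (y - x) * lweight a z"
    using assms by (intro MVT2) (auto intro: linv_deriv)
  then obtain z where "x < z" "z < y" "linv a y - linv a x = (y - x) * lweight a z" by blast
  then show ?thesis using assms lweight_antimono[of a x z] by (auto intro!: mult_left_mono)
qed auto

lemma pm_map_linv:
  assumes "0 \<le> a" "0 < x" "x < 1"
  shows "pm_map a (linv a x) = x"
  using linv_less_half[OF assms] lbranch_linv[OF assms(1,2)] by (simp add: pm_map_def lbranch_def)

lemma pm_map_rinv: "0 \<le> x \<Longrightarrow> pm_map a ((x + 1) / 2) = x"
  by (simp add: pm_map_def field_simps)

section \<open>Transfer operators\<close>

text \<open>The end points are left out because the inverse branches fail there: \<open>linv\<close>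
  is defined through positive points only, and \<open>linv a 1 = 1/2\<close> is sent to 0 by
  \<open>pm_map a\<close>.\<close>

abbreviation unit_leb :: "real measure" where
  "unit_leb \<equiv> lebesgue_on {0<..<1}"

definition transfer :: "real \<Rightarrow> (real \<Rightarrow> real) \<Rightarrow> real \<Rightarrow> real" where
  "transfer a f x = f (linv a x) * lweight a x + f ((x + 1) / 2) / 2"

lemma integrable_lebesgue_on_iff:
  fixes f :: "real \<Rightarrow> real"
  assumes "S \<in> sets lebesgue"
  shows "integrable (lebesgue_on S) f \<longleftrightarrow> f absolutely_integrable_on S"
  using assms by (simp add: integrable_restrict_space set_integrable_def)

lemma linv_image:
  assumes "0 \<le> a" shows "linv a ` {0<..<1} = {0<..<1/2}"
proof
  show "linv a ` {0<..<1} \<subseteq> {0<..<1/2}" using linv_pos linv_less_half assms by auto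
  show "{0<..<1/2} \<subseteq> linv a ` {0<..<1}"
  proof
    fix y :: real assume y: "y \<in> {0<..<1/2}"
    have "0 < lbranch a y" using y by (auto simp: lbranch_def add_pos_nonneg)
    moreover have "lbranch a y < 1" using lbranch_strict_mono[of a y "1/2"] y assms lbranch_half by auto
    moreover have "linv a (lbranch a y) = y"
      using lbranch_linv[of a "lbranch a y"] linv_pos[of a "lbranch a y"] \<open>0 < lbranch a y\<close> assms y
        lbranch_strict_mono[of a y "linv a (lbranch a y)"] lbranch_strict_mono[of a "linv a (lbranch a y)" y]
      by (cases y "linv a (lbranch a y)" rule: linorder_cases) auto
    ultimately show "y \<in> linv a ` {0<..<1}" by (metis greaterThanLessThan_iff imageI)
  qed
qed

lemma rinv_image: "(\<lambda>x::real. (x + 1) / 2) ` {0<..<1} = {1/2<..<1}"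
proof
  show "{1/2<..<1} \<subseteq> (\<lambda>x::real. (x + 1) / 2) ` {0<..<1}"
  proof
    fix y :: real assume "y \<in> {1/2<..<1}"
    then show "y \<in> (\<lambda>x::real. (x + 1) / 2) ` {0<..<1}" by (intro image_eqI[where x = "2*y-1"]) auto
  qed
qed auto

text \<open>Change of variables on each branch. Integrability is stated as an equivalence since both
  directions are used: from \<open>f\<close> to \<open>transfer a f\<close>, and backwards in
  \<open>ebounded_comp\<close>, where it yields the measurability of a composition with
  \<open>pm_map a\<close>.\<close>

lemma branch_duality:
  fixes f g :: "real \<Rightarrow> real"
  assumes "0 \<le> a" "a \<le> 1"
  shows "integrable unit_leb (\<lambda>x. f x * g (pm_map a x)) \<longleftrightarrow>
      integrable unit_leb (\<lambda>x. f (linv a x) * lweight a x * g x) \<and>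
      integrable unit_leb (\<lambda>x. f ((x + 1) / 2) / 2 * g x)" (is "?A \<longleftrightarrow> ?B \<and> ?C")
    and "integrable unit_leb (\<lambda>x. f x * g (pm_map a x)) \<Longrightarrow>
      (\<integral>x. transfer a f x * g x \<partial>unit_leb) = (\<integral>x. f x * g (pm_map a x) \<partial>unit_leb)"
proof -
  let ?h = "\<lambda>x. f x * g (pm_map a x)"
  let ?I = "{0<..<1::real}" and ?J = "{0<..<1/2::real}" and ?K = "{1/2<..<1::real}"
  let ?l = "\<lambda>x. f (linv a x) * lweight a x * g x" and ?r = "\<lambda>x. f ((x + 1) / 2) / 2 * g x"
  have linj: "inj_on (linv a) ?I"
    using linv_strict_mono assms by (intro linorder_inj_onI) (auto, fastforce)
  have l: "(\<lambda>x. \<bar>lweight a x\<bar> * ?h (linv a x)) absolutely_integrable_on ?I \<and>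
      integral ?I (\<lambda>x. \<bar>lweight a x\<bar> * ?h (linv a x)) = b
     \<longleftrightarrow> ?h absolutely_integrable_on ?J \<and> integral ?J ?h = b" for b
    using has_absolute_integral_change_of_variables_1'[OF _ _ linj, of "lweight a" ?h b]
    using has_field_derivative_at_within[OF linv_deriv] assms(1) by (auto simp: linv_image)
  have r: "(\<lambda>x. \<bar>1/2\<bar> * ?h ((x + 1) / 2)) absolutely_integrable_on ?I \<and>
      integral ?I (\<lambda>x. \<bar>1/2\<bar> * ?h ((x + 1) / 2)) = b
     \<longleftrightarrow> ?h absolutely_integrable_on ?K \<and> integral ?K ?h = b" for b
  proof -
    have "((\<lambda>x::real. (x + 1) / 2) has_real_derivative 1/2) (at x within ?I)" for x
      by (auto intro!: derivative_eq_intros)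
    moreover have "inj_on (\<lambda>x::real. (x + 1) / 2) ?I" by (simp add: inj_on_def)
    ultimately show ?thesis
      using has_absolute_integral_change_of_variables_1'[of ?I "\<lambda>x. (x + 1) / 2" "\<lambda>_. 1/2" ?h b]
      unfolding rinv_image by simp
  qed
  have leq: "\<bar>lweight a x\<bar> * ?h (linv a x) = ?l x" if "x \<in> ?I" for x
    using that assms pm_map_linv[of a x] lweight_bounds[of a x] by auto
  have req: "\<bar>1/2\<bar> * ?h ((x + 1) / 2) = ?r x" if "x \<in> ?I" for x
    using that pm_map_rinv[of x a] by auto
  have leq_int: "(\<lambda>x. \<bar>lweight a x\<bar> * ?h (linv a x)) absolutely_integrable_on ?I \<longleftrightarrow> ?l absolutely_integrable_on ?I"
    by (rule set_integrable_cong[OF refl refl leq])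
  have leq_val: "integral ?I (\<lambda>x. \<bar>lweight a x\<bar> * ?h (linv a x)) = integral ?I ?l"
    by (rule integral_cong[OF leq])
  have l1: "?l absolutely_integrable_on ?I \<longleftrightarrow> ?h absolutely_integrable_on ?J"
    and l2: "?h absolutely_integrable_on ?J \<Longrightarrow> integral ?I ?l = integral ?J ?h"
    using l[unfolded leq_int leq_val] by blast+
  have req_int: "(\<lambda>x. \<bar>1/2\<bar> * ?h ((x + 1) / 2)) absolutely_integrable_on ?I \<longleftrightarrow> ?r absolutely_integrable_on ?I"
    by (rule set_integrable_cong[OF refl refl req])
  have req_val: "integral ?I (\<lambda>x. \<bar>1/2\<bar> * ?h ((x + 1) / 2)) = integral ?I ?r"
    by (rule integral_cong[OF req])
  have r1: "?r absolutely_integrable_on ?I \<longleftrightarrow> ?h absolutely_integrable_on ?K"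
    and r2: "?h absolutely_integrable_on ?K \<Longrightarrow> integral ?I ?r = integral ?K ?h"
    using r[unfolded req_int req_val] by blast+
  \<comment> \<open>The two half intervals miss only the point 1/2, a negligible set.\<close>
  have split: "?h absolutely_integrable_on ?I \<longleftrightarrow> ?h absolutely_integrable_on ?J \<and> ?h absolutely_integrable_on ?K"
  proof
    assume "?h absolutely_integrable_on ?I"
    then show "?h absolutely_integrable_on ?J \<and> ?h absolutely_integrable_on ?K"
      by (auto intro: set_integrable_subset)
  next
    assume "?h absolutely_integrable_on ?J \<and> ?h absolutely_integrable_on ?K"
    then have "?h absolutely_integrable_on (?J \<union> ?K)" by (auto intro!: set_integrable_Un)
    then show "?h absolutely_integrable_on ?I"
      by (rule absolutely_integrable_spike_set)
        (auto intro!: negligible_subset[OF negligible_sing[of "1/2"]])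
  qed
  show eq: "?A \<longleftrightarrow> ?B \<and> ?C"
    using split l1 r1 by (simp add: integrable_lebesgue_on_iff)
  assume A: ?A
  then have B: ?B and C: ?C using eq by auto
  have "(\<integral>x. transfer a f x * g x \<partial>unit_leb) = (\<integral>x. ?l x + ?r x \<partial>unit_leb)"
    by (simp add: transfer_def algebra_simps)
  also have "\<dots> = (\<integral>x. ?l x \<partial>unit_leb) + (\<integral>x. ?r x \<partial>unit_leb)"
    using B C by (rule Bochner_Integration.integral_add)
  also have "\<dots> = integral ?I ?l + integral ?I ?r"
    using lebesgue_integral_eq_integral[OF B] lebesgue_integral_eq_integral[OF C] by simp
  also have "\<dots> = integral ?J ?h + integral ?K ?h"
    using l2 r2 A split by (simp add: integrable_lebesgue_on_iff)
  also have "\<dots> = integral (?J \<union> ?K) ?h"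
    using A split by (intro Henstock_Kurzweil_Integration.integral_Un[symmetric])
      (auto simp: integrable_lebesgue_on_iff absolutely_integrable_on_def)
  also have "\<dots> = integral ?I ?h"
    by (rule integral_spike_set) (auto intro!: negligible_subset[OF negligible_sing[of "1/2"]])
  also have "\<dots> = (\<integral>x. ?h x \<partial>unit_leb)"
    using A by (simp add: lebesgue_integral_eq_integral)
  finally show "(\<integral>x. transfer a f x * g x \<partial>unit_leb) = (\<integral>x. f x * g (pm_map a x) \<partial>unit_leb)" .
qed

section \<open>Nonnegative decreasing functions\<close>

definition decr :: "(real \<Rightarrow> real) \<Rightarrow> bool" where
  "decr f \<longleftrightarrow> (\<forall>x\<in>{0<..<1}. 0 \<le> f x) \<and> antimono_on {0<..<1} f"

lemma decrI:
  "(\<And>x. 0 < x \<Longrightarrow> x < 1 \<Longrightarrow> 0 \<le> f x) \<Longrightarrow>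
   (\<And>x y. 0 < x \<Longrightarrow> x \<le> y \<Longrightarrow> y < 1 \<Longrightarrow> f y \<le> f x) \<Longrightarrow> decr f"
  by (auto simp: decr_def monotone_on_def)

lemma decr_nonneg: "decr f \<Longrightarrow> 0 < x \<Longrightarrow> x < 1 \<Longrightarrow> 0 \<le> f x"
  by (auto simp: decr_def)

lemma decrD: "decr f \<Longrightarrow> 0 < x \<Longrightarrow> x \<le> y \<Longrightarrow> y < 1 \<Longrightarrow> f y \<le> f x"
  by (auto simp: decr_def monotone_on_def)

lemma decr_const: "0 \<le> c \<Longrightarrow> decr (\<lambda>_. c)"
  by (auto intro: decrI)

lemma decr_add: "decr f \<Longrightarrow> decr g \<Longrightarrow> decr (\<lambda>x. f x + g x)"
  by (auto intro!: decrI add_nonneg_nonneg add_mono dest: decr_nonneg decrD)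

text \<open>Nonnegativity is part of \<open>decr\<close> for the sake of this closure
  property.\<close>

lemma decr_mult: "decr f \<Longrightarrow> decr g \<Longrightarrow> decr (\<lambda>x. f x * g x)"
  by (auto intro!: decrI mult_nonneg_nonneg mult_mono dest: decrD intro: decr_nonneg)

lemma decr_measurable:
  assumes "decr f" shows "f \<in> borel_measurable unit_leb"
proof -
  let ?I = "{0<..<1::real}"
  have "mono_on ?I (\<lambda>x. - f x)" using decrD[OF assms] by (auto simp: monotone_on_def)
  then have "(\<lambda>x. - f x) \<in> borel_measurable (restrict_space borel ?I)"
    by (rule borel_measurable_mono_on_fnc)
  then have "f \<in> borel_measurable (restrict_space borel ?I)" by simp
  then have "(\<lambda>x. indicator ?I x *\<^sub>R f x) \<in> borel_measurable borel"
    by (subst borel_measurable_restrict_space_iff[symmetric]) auto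
  then have "(\<lambda>x. indicator ?I x *\<^sub>R f x) \<in> borel_measurable lebesgue"
    by (intro measurable_completion) simp
  then show ?thesis by (subst borel_measurable_restrict_space_iff) auto
qed

lemma decr_integrable_bound:
  assumes "decr f" "integrable unit_leb g" "\<And>x. 0 < x \<Longrightarrow> x < 1 \<Longrightarrow> f x \<le> g x"
  shows "integrable unit_leb f"
  using assms(2) decr_measurable[OF assms(1)]
  by (rule Bochner_Integration.integrable_bound) (use assms decr_nonneg[OF assms(1)] in \<open>force intro!: AE_I2\<close>)

lemma unit_finite [simp]: "finite_measure unit_leb"
  by (rule finite_measure_lebesgue_on) auto

lemma unit_integrable_const [simp]: "integrable unit_leb (\<lambda>_. c :: real)"
  by (rule finite_measure.integrable_const) simp

lemma unit_integral_const [simp]: "(\<integral>x. c \<partial>unit_leb) = (c :: real)"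
  by (simp add: measure_restrict_space)

lemma unit_measure [simp]: "measure unit_leb {0<..<1} = 1"
  by (simp add: measure_restrict_space)

lemma unit_integral_mono:
  "integrable unit_leb f \<Longrightarrow> integrable unit_leb g \<Longrightarrow> (\<And>x. 0 < x \<Longrightarrow> x < 1 \<Longrightarrow> f x \<le> (g x :: real)) \<Longrightarrow>
   (\<integral>x. f x \<partial>unit_leb) \<le> (\<integral>x. g x \<partial>unit_leb)"
  by (rule integral_mono) auto

lemma unit_integral_nonneg:
  "(\<And>x. 0 < x \<Longrightarrow> x < 1 \<Longrightarrow> 0 \<le> (f x :: real)) \<Longrightarrow> 0 \<le> (\<integral>x. f x \<partial>unit_leb)"
  by (rule Bochner_Integration.integral_nonneg) auto

lemma unit_integral_cong:
  "(\<And>x. 0 < x \<Longrightarrow> x < 1 \<Longrightarrow> f x = (g x :: real)) \<Longrightarrow> (\<integral>x. f x \<partial>unit_leb) = (\<integral>x. g x \<partial>unit_leb)"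
  by (rule Bochner_Integration.integral_cong) auto

lemma unit_integrable_cong:
  "(\<And>x. 0 < x \<Longrightarrow> x < 1 \<Longrightarrow> f x = (g x :: real)) \<Longrightarrow> integrable unit_leb f \<longleftrightarrow> integrable unit_leb g"
  by (rule Bochner_Integration.integrable_cong) auto

lemma transfer_linear:
  "transfer a (\<lambda>x. f x + g x) = (\<lambda>x. transfer a f x + transfer a g x)"
  "transfer a (\<lambda>x. f x - g x) = (\<lambda>x. transfer a f x - transfer a g x)"
  "transfer a (\<lambda>x. c * f x) = (\<lambda>x. c * transfer a f x)"
  by (auto simp: transfer_def fun_eq_iff field_simps)

lemma linv_unit: "0 \<le> a \<Longrightarrow> 0 < x \<Longrightarrow> x < 1 \<Longrightarrow> 0 < linv a x \<and> linv a x < 1"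
  using linv_pos[of a x] linv_less_half[of a x] by auto

lemma transfer_mono:
  assumes "0 \<le> a" "a \<le> 1" "\<And>x. 0 < x \<Longrightarrow> x < 1 \<Longrightarrow> f x \<le> g x" "0 < x" "x < 1"
  shows "transfer a f x \<le> transfer a g x"
  unfolding transfer_def using assms linv_unit[of a x] lweight_bounds[of a x]
  by (intro add_mono mult_right_mono divide_right_mono) auto

lemma transfer_cong:
  assumes "0 \<le> a" "\<And>x. 0 < x \<Longrightarrow> x < 1 \<Longrightarrow> f x = g x" "0 < x" "x < 1"
  shows "transfer a f x = transfer a g x"
  unfolding transfer_def using assms linv_unit[of a x] by auto

lemma transfer_mult:
  assumes "0 \<le> a" "0 < x" "x < 1"
  shows "transfer a (\<lambda>x. f x * g (pm_map a x)) x = transfer a f x * g x"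
  using assms pm_map_linv[of a x] pm_map_rinv[of x a] by (simp add: transfer_def algebra_simps)

lemma transfer_abs:
  assumes "0 \<le> a" "a \<le> 1" "0 < x" "x < 1"
  shows "\<bar>transfer a f x\<bar> \<le> transfer a (\<lambda>x. \<bar>f x\<bar>) x"
proof -
  have "\<bar>transfer a f x\<bar> \<le> \<bar>f (linv a x) * lweight a x\<bar> + \<bar>f ((x + 1) / 2) / 2\<bar>"
    unfolding transfer_def by (rule abs_triangle_ineq)
  then show ?thesis using lweight_bounds[of a x] assms by (simp add: transfer_def abs_mult)
qed

text \<open>Both branches are increasing and convex, so their inverses are increasing with
  decreasing derivatives, and the operator yields a sum of products of nonnegative decreasing
  functions.\<close>

lemma transfer_decr:
  assumes "0 \<le> a" "a \<le> 1" "decr f"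
  shows "decr (transfer a f)"
proof (rule decrI)
  fix x :: real assume "0 < x" "x < 1"
  then show "0 \<le> transfer a f x" unfolding transfer_def
    using assms(1,2) linv_unit[of a x] lweight_bounds[of a x]
    by (auto intro!: add_nonneg_nonneg mult_nonneg_nonneg decr_nonneg[OF assms(3)])
next
  fix x y :: real assume xy: "0 < x" "x \<le> y" "y < 1"
  have "f (linv a y) * lweight a y \<le> f (linv a x) * lweight a x"
    using xy assms linv_unit[of a x] linv_unit[of a y] lweight_bounds[of a y]
    by (intro mult_mono decrD[OF assms(3)] linv_mono lweight_antimono decr_nonneg[OF assms(3)]) auto
  moreover have "f ((y + 1) / 2) \<le> f ((x + 1) / 2)"
    using xy by (intro decrD[OF assms(3)]) auto
  ultimately show "transfer a f y \<le> transfer a f x" unfolding transfer_def by simp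
qed

lemma transfer_integral:
  assumes "0 \<le> a" "a \<le> 1" "integrable unit_leb f"
  shows "integrable unit_leb (transfer a f)" "(\<integral>x. transfer a f x \<partial>unit_leb) = (\<integral>x. f x \<partial>unit_leb)"
  using branch_duality[OF assms(1,2), of f "\<lambda>_. 1"] assms(3) unfolding transfer_def[abs_def] by auto

section \<open>Essentially bounded observables\<close>

definition ebounded :: "real \<Rightarrow> (real \<Rightarrow> real) \<Rightarrow> bool" where
  "ebounded c g \<longleftrightarrow> g \<in> borel_measurable unit_leb \<and> (AE x in unit_leb. \<bar>g x\<bar> \<le> c)"

lemma ebounded_integrable_mult:
  assumes "ebounded c g" "integrable unit_leb f"
  shows "integrable unit_leb (\<lambda>x. f x * g x)"
proof -
  have "integrable unit_leb (\<lambda>x. c * f x)" using assms by simp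
  then show ?thesis
  proof (rule Bochner_Integration.integrable_bound)
    show "(\<lambda>x. f x * g x) \<in> borel_measurable unit_leb"
      using assms by (auto simp: ebounded_def)
    have "AE x in unit_leb. \<bar>g x\<bar> \<le> c" using assms by (simp add: ebounded_def)
    then show "AE x in unit_leb. norm (f x * g x) \<le> norm (c * f x)"
    proof eventually_elim
      case (elim x)
      then have "\<bar>f x\<bar> * \<bar>g x\<bar> \<le> \<bar>f x\<bar> * \<bar>c\<bar>" by (intro mult_left_mono) auto
      then show ?case by (simp add: abs_mult mult.commute)
    qed
  qed
qed

lemma ebounded_integral_le:
  assumes "ebounded c g" "integrable unit_leb f"
  shows "\<bar>\<integral>x. f x * g x \<partial>unit_leb\<bar> \<le> c * (\<integral>x. \<bar>f x\<bar> \<partial>unit_leb)"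
proof -
  have ae: "AE x in unit_leb. \<bar>g x\<bar> \<le> c" using assms by (simp add: ebounded_def)
  have "\<bar>\<integral>x. f x * g x \<partial>unit_leb\<bar> \<le> (\<integral>x. \<bar>f x * g x\<bar> \<partial>unit_leb)"
    by (rule integral_abs_bound)
  also have "\<dots> \<le> (\<integral>x. c * \<bar>f x\<bar> \<partial>unit_leb)"
  proof (rule integral_mono_AE)
    show "integrable unit_leb (\<lambda>x. \<bar>f x * g x\<bar>)"
      using ebounded_integrable_mult[OF assms] by simp
    show "integrable unit_leb (\<lambda>x. c * \<bar>f x\<bar>)" using assms by simp
    show "AE x in unit_leb. \<bar>f x * g x\<bar> \<le> c * \<bar>f x\<bar>"
      using ae by eventually_elim (auto simp: abs_mult mult.commute[of c] intro!: mult_left_mono)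
  qed
  finally show ?thesis by simp
qed

lemma ebounded_mult:
  assumes "ebounded c f" "ebounded d g"
  shows "ebounded (c * d) (\<lambda>x. f x * g x)"
proof -
  have "AE x in unit_leb. \<bar>f x\<bar> \<le> c" "AE x in unit_leb. \<bar>g x\<bar> \<le> d"
    using assms by (auto simp: ebounded_def)
  then have "AE x in unit_leb. \<bar>f x * g x\<bar> \<le> c * d"
    by eventually_elim (auto simp: abs_mult intro!: mult_mono)
  then show ?thesis using assms by (auto simp: ebounded_def)
qed

lemma ebounded_const: "ebounded \<bar>c\<bar> (\<lambda>_. c)"
  by (auto simp: ebounded_def)

lemma ebounded_prod:
  "(\<And>i. i \<in> A \<Longrightarrow> ebounded (c i) (g i)) \<Longrightarrow> ebounded (\<Prod>i\<in>A. c i) (\<lambda>x. \<Prod>i\<in>A. g i x)"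
proof (induction A rule: infinite_finite_induct)
  case (insert i A)
  then show ?case using ebounded_mult[of "c i" "g i"] by simp
qed (use ebounded_const[of 1] in auto)

text \<open>The map is non-singular: by duality with the constant 1, the preimage of the exceptional
  set of \<open>g\<close> is null.\<close>

lemma ebounded_comp:
  assumes a: "0 \<le> a" "a \<le> 1" and g: "ebounded c g"
  shows "ebounded c (\<lambda>x. g (pm_map a x))"
proof -
  have wd: "decr (lweight a)"
  proof (rule decrI)
    show "0 \<le> lweight a x" if "0 < x" "x < 1" for x using lweight_bounds[of a x] that a by auto
  qed (use lweight_antimono a in auto)
  \<comment> \<open>Integrability of the composition is read off from its two inverse-branch terms,
    and it is the source of measurability.\<close>
  have int: "integrable unit_leb (\<lambda>x. 1 * g' (pm_map a x))" if "ebounded c' g'" for c' g'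
  proof -
    have "integrable unit_leb (lweight a)"
      by (rule decr_integrable_bound[OF wd unit_integrable_const[of 1]])
        (use lweight_bounds a in auto)
    from ebounded_integrable_mult[OF that this] ebounded_integrable_mult[OF that unit_integrable_const[of "1/2"]]
    show ?thesis by (subst branch_duality(1)[OF a]) auto
  qed
  \<comment> \<open>The indicator of the exceptional set of \<open>g\<close>.\<close>
  define h where "h = (\<lambda>x. if \<bar>g x\<bar> \<le> c then 0 else 1 :: real)"
  have gm [measurable]: "g \<in> borel_measurable unit_leb" using g by (simp add: ebounded_def)
  have h: "ebounded 1 h" unfolding ebounded_def h_def by auto
  have ae: "AE x in unit_leb. \<bar>g x\<bar> \<le> c" using g by (simp add: ebounded_def)
  have "(\<integral>x. 1 * h (pm_map a x) \<partial>unit_leb) = (\<integral>x. transfer a (\<lambda>_. 1) x * h x \<partial>unit_leb)"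
    using branch_duality(2)[OF a, of "\<lambda>_. 1" h] int[OF h] by auto
  also have "\<dots> = 0"
    by (rule integral_eq_zero_AE) (use ae in \<open>eventually_elim, auto simp: h_def\<close>)
  finally have "AE x in unit_leb. h (pm_map a x) = 0"
    using int[OF h] integral_nonneg_eq_0_iff_AE[of unit_leb "\<lambda>x. h (pm_map a x)"]
    by (auto simp: h_def)
  then have "AE x in unit_leb. \<bar>g (pm_map a x)\<bar> \<le> c"
    by eventually_elim (auto simp: h_def split: if_splits)
  then show ?thesis using int[OF g] by (auto simp: ebounded_def)
qed

section \<open>Iterates along a parameter sequence\<close>

definition shift :: "nat \<Rightarrow> (nat \<Rightarrow> real) \<Rightarrow> nat \<Rightarrow> real" where
  "shift m \<alpha> = (\<lambda>i. \<alpha> (m + i))"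

primrec transfer_iter :: "(nat \<Rightarrow> real) \<Rightarrow> nat \<Rightarrow> (real \<Rightarrow> real) \<Rightarrow> real \<Rightarrow> real" where
  "transfer_iter \<alpha> 0 f = f"
| "transfer_iter \<alpha> (Suc n) f = transfer (\<alpha> (Suc n)) (transfer_iter \<alpha> n f)"

text \<open>Iteration starts at index 1, and the shifted sequence has
  \<open>\<alpha> (m + 1)\<close> there, so it drives exactly the steps after step
  \<open>m\<close>.\<close>

lemma transfer_iter_add:
  "transfer_iter \<alpha> (m + n) f = transfer_iter (shift m \<alpha>) n (transfer_iter \<alpha> m f)"
  by (induction n) (auto simp: shift_def)

lemma pm_iter_add: "pm_iter \<alpha> (m + n) x = pm_iter (shift m \<alpha>) n (pm_iter \<alpha> m x)"
  by (induction n) (auto simp: shift_def)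

lemma transfer_iter_linear:
  "transfer_iter \<alpha> n (\<lambda>x. f x + g x) = (\<lambda>x. transfer_iter \<alpha> n f x + transfer_iter \<alpha> n g x)"
  "transfer_iter \<alpha> n (\<lambda>x. f x - g x) = (\<lambda>x. transfer_iter \<alpha> n f x - transfer_iter \<alpha> n g x)"
  "transfer_iter \<alpha> n (\<lambda>x. c * f x) = (\<lambda>x. c * transfer_iter \<alpha> n f x)"
  by (induction n) (auto simp: transfer_linear)

locale pm_sequence =
  fixes \<beta> :: real and \<alpha> :: "nat \<Rightarrow> real"
  assumes beta: "0 < \<beta>" "\<beta> < 1" and adm: "admissible \<beta> \<alpha>"
begin

lemma alpha: "0 < \<alpha> (Suc n)" "\<alpha> (Suc n) \<le> \<beta>" "0 \<le> \<alpha> (Suc n)" "\<alpha> (Suc n) \<le> 1"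
  using adm beta unfolding admissible_def by (auto simp: less_imp_le intro: order.trans less_imp_le)

lemma shift_pm: "pm_sequence \<beta> (shift m \<alpha>)"
  using beta adm by (auto simp: pm_sequence_def admissible_def shift_def)

lemma iter_mono:
  assumes "\<And>x. 0 < x \<Longrightarrow> x < 1 \<Longrightarrow> f x \<le> g x" "0 < x" "x < 1"
  shows "transfer_iter \<alpha> n f x \<le> transfer_iter \<alpha> n g x"
  using assms(2,3) by (induction n arbitrary: x) (auto intro!: transfer_mono alpha assms(1))

text \<open>A pointwise duality: the second factor takes the same value \<open>g x\<close> at all
  preimages of \<open>x\<close> under the \<open>n\<close>-step map. It serves both to move
  \<open>G\<close> to its starting time and to split off the factors of \<open>H\<close> one by
  one.\<close>

lemma iter_mult:
  assumes "0 < x" "x < 1"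
  shows "transfer_iter \<alpha> n (\<lambda>x. f x * g (pm_iter \<alpha> n x)) x = transfer_iter \<alpha> n f x * g x"
  using assms
proof (induction n arbitrary: x g)
  case (Suc n)
  have "transfer_iter \<alpha> (Suc n) (\<lambda>x. f x * g (pm_iter \<alpha> (Suc n) x)) x =
      transfer (\<alpha> (Suc n)) (\<lambda>x. transfer_iter \<alpha> n f x * g (pm_map (\<alpha> (Suc n)) x)) x"
    using Suc.IH[of _ "\<lambda>x. g (pm_map (\<alpha> (Suc n)) x)"] Suc.prems
    by (auto intro!: transfer_cong alpha)
  also have "\<dots> = transfer_iter \<alpha> (Suc n) f x * g x"
    using Suc.prems alpha by (simp add: transfer_mult)
  finally show ?case .
qed auto

lemma iter_decr: "decr f \<Longrightarrow> decr (transfer_iter \<alpha> n f)"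
  by (induction n) (auto intro!: transfer_decr alpha)

lemma iter_integral:
  assumes "integrable unit_leb f"
  shows "integrable unit_leb (transfer_iter \<alpha> n f)"
    "(\<integral>x. transfer_iter \<alpha> n f x \<partial>unit_leb) = (\<integral>x. f x \<partial>unit_leb)"
proof -
  have "integrable unit_leb (transfer_iter \<alpha> n f) \<and>
    (\<integral>x. transfer_iter \<alpha> n f x \<partial>unit_leb) = (\<integral>x. f x \<partial>unit_leb)"
    using assms by (induction n) (auto simp: transfer_integral alpha)
  then show "integrable unit_leb (transfer_iter \<alpha> n f)"
    "(\<integral>x. transfer_iter \<alpha> n f x \<partial>unit_leb) = (\<integral>x. f x \<partial>unit_leb)" by auto
qed

lemma iter_dual:
  assumes "integrable unit_leb (\<lambda>x. f x * g (pm_iter \<alpha> n x))"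
  shows "(\<integral>x. transfer_iter \<alpha> n f x * g x \<partial>unit_leb) = (\<integral>x. f x * g (pm_iter \<alpha> n x) \<partial>unit_leb)"
  using iter_integral(2)[OF assms, of n]
    unit_integral_cong[OF iter_mult[where n = n and f = f and g = g]] by auto

lemma iter_abs:
  assumes "0 < x" "x < 1"
  shows "\<bar>transfer_iter \<alpha> n f x\<bar> \<le> transfer_iter \<alpha> n (\<lambda>x. \<bar>f x\<bar>) x"
  using assms
proof (induction n arbitrary: x)
  case (Suc n)
  have "\<bar>transfer_iter \<alpha> (Suc n) f x\<bar> \<le> transfer (\<alpha> (Suc n)) (\<lambda>x. \<bar>transfer_iter \<alpha> n f x\<bar>) x"
    using transfer_abs Suc.prems alpha by simp
  also have "\<dots> \<le> transfer_iter \<alpha> (Suc n) (\<lambda>x. \<bar>f x\<bar>) x"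
    using Suc alpha by (auto intro!: transfer_mono)
  finally show ?case .
qed auto

text \<open>A positive linear operator that preserves integrals does not increase the L1
  norm.\<close>

lemma iter_L1_le:
  assumes "integrable unit_leb f"
  shows "(\<integral>x. \<bar>transfer_iter \<alpha> n f x\<bar> \<partial>unit_leb) \<le> (\<integral>x. \<bar>f x\<bar> \<partial>unit_leb)"
proof -
  have "(\<integral>x. \<bar>transfer_iter \<alpha> n f x\<bar> \<partial>unit_leb) \<le> (\<integral>x. transfer_iter \<alpha> n (\<lambda>x. \<bar>f x\<bar>) x \<partial>unit_leb)"
    using assms by (intro unit_integral_mono iter_abs) (auto intro!: iter_integral)
  then show ?thesis using iter_integral(2)[of "\<lambda>x. \<bar>f x\<bar>" n] assms by simp
qed

lemma ebounded_iter: "ebounded c g \<Longrightarrow> ebounded c (\<lambda>x. g (pm_iter \<alpha> n x))"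
proof (induction n arbitrary: g)
  case (Suc n)
  show ?case using Suc.IH[OF ebounded_comp[OF alpha(3,4) Suc.prems, of n]] by simp
qed auto

end

section \<open>Densities in the cone\<close>

text \<open>Without the monotonicity of \<open>x powr (\<beta> + 1) * f x\<close>, the pole bound is still invariant under
  the transfer operators if its constant is at least \<open>3 / (1 - \<beta>)\<close>; the factor \<open>12\<close> makes it also
  dominate \<open>2 powr \<beta> * (2 + \<beta>)\<close>.\<close>

definition cone_density :: "real \<Rightarrow> (real \<Rightarrow> real) \<Rightarrow> bool" where
  "cone_density \<beta> F \<longleftrightarrow> decr F \<and> integrable unit_leb F \<and> (\<integral>x. F x \<partial>unit_leb) = 1 \<and>
     (\<forall>x\<in>{0<..<1}. F x \<le> 12 / (1 - \<beta>) * x powr (- \<beta>))"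

lemma unit_integral_step:
  assumes "0 \<le> s" "s \<le> t" "t \<le> 1"
  shows "integrable unit_leb (\<lambda>x. if s \<le> x \<and> x < t then c else 0 :: real)"
    and "(\<integral>x. (if s \<le> x \<and> x < t then c else 0) \<partial>unit_leb) = c * (t - s)"
proof -
  have sets: "{s..<t} \<inter> {0<..<1} \<in> sets unit_leb"
    by (subst sets_restrict_space_iff) auto
  have 1: "(\<lambda>x. if s \<le> x \<and> x < t then c else 0 :: real) = (\<lambda>x. c * indicator {s..<t} x)"
    by (auto simp: fun_eq_iff)
  have "measure unit_leb ({s..<t} \<inter> {0<..<1}) = measure lebesgue ({s..<t} \<inter> {0<..<1})"
    by (subst measure_restrict_space) auto
  also have "\<dots> = measure lebesgue {s<..<t}"
    by (rule measure_negligible_symdiff)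
      (use assms in \<open>auto intro!: negligible_subset[OF negligible_sing[of s]] simp: not_less\<close>)
  also have "\<dots> = t - s" using assms by simp
  finally have 2: "measure unit_leb ({s..<t} \<inter> {0<..<1}) = t - s" .
  have "integrable unit_leb (indicat_real ({s..<t} \<inter> {0<..<1}))"
    using sets by (intro integrable_real_indicator)
      (auto simp: finite_measure.emeasure_finite top.not_eq_extremum[symmetric])
  then have 3: "integrable unit_leb (indicat_real {s..<t})"
    by (subst unit_integrable_cong[where g = "indicat_real ({s..<t} \<inter> {0<..<1})"]) (auto simp: indicator_def)
  then show "integrable unit_leb (\<lambda>x. if s \<le> x \<and> x < t then c else 0 :: real)"
    unfolding 1 by simp
  have "(\<integral>x. indicat_real {s..<t} x \<partial>unit_leb) = t - s"
    using 2 by (simp add: Int_commute)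
  then show "(\<integral>x. (if s \<le> x \<and> x < t then c else 0) \<partial>unit_leb) = c * (t - s)"
    unfolding 1 by simp
qed

lemma unit_integrable_if:
  assumes "integrable unit_leb f"
  shows "integrable unit_leb (\<lambda>x. if x < t then f x else 0 :: real)"
    and "integrable unit_leb (\<lambda>x. if t \<le> x then f x else 0 :: real)"
proof -
  have "{..<t} \<inter> {0<..<1} \<in> sets unit_leb" "{t..} \<inter> {0<..<1} \<in> sets unit_leb"
    by (subst sets_restrict_space_iff; auto)+
  note i = integrable_mult_indicator[OF this(1) assms] integrable_mult_indicator[OF this(2) assms]
  show "integrable unit_leb (\<lambda>x. if x < t then f x else 0 :: real)"
    by (rule iffD1[OF unit_integrable_cong i(1)]) (auto simp: indicator_def)
  show "integrable unit_leb (\<lambda>x. if t \<le> x then f x else 0 :: real)"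
    by (rule iffD1[OF unit_integrable_cong i(2)]) (auto simp: indicator_def)
qed

text \<open>On \<open>(0, x)\<close> a decreasing \<open>f\<close> is at least
  \<open>f x\<close>.\<close>

lemma decr_le_inverse:
  assumes "decr f" "integrable unit_leb f" "0 < x" "x < 1"
  shows "x * f x \<le> (\<integral>x. f x \<partial>unit_leb)"
proof -
  have "x * f x = (\<integral>y. (if 0 \<le> y \<and> y < x then f x else 0) \<partial>unit_leb)"
    using unit_integral_step(2)[of 0 x "f x"] assms by (simp add: mult.commute)
  also have "\<dots> \<le> (\<integral>x. f x \<partial>unit_leb)"
    using unit_integral_step(1)[of 0 x "f x"] assms
    by (intro unit_integral_mono) (auto intro: decrD decr_nonneg)
  finally show ?thesis .
qed

text \<open>Bernoulli's inequality for exponents in [0, 1], read off from Young's inequality with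
  weights \<open>b\<close> and \<open>1 - b\<close>.\<close>

lemma powr_one_plus_le:
  fixes u :: real
  assumes "0 \<le> b" "b \<le> 1" "0 \<le> u"
  shows "(1 + u) powr b \<le> 1 + b * u"
  using Youngs_inequality_0[of b "1 - b" "1 + u" 1] assms by (simp add: algebra_simps)

text \<open>A balance at \<open>x\<close>. With \<open>u = (2 * y) powr a\<close> at the left
  preimage \<open>y\<close>, the weight beats the growth of the pole by the factor
  \<open>1 - (1 - \<beta>) * u / 3\<close>; since \<open>u \<ge> x powr \<beta>\<close>, this gains
  at least \<open>12 / 3 = 4\<close>. The right branch costs at most 1, because its preimage lies
  above 1/2, where a decreasing density is at most 2.\<close>

lemma transfer_cone_density:
  assumes b: "0 < \<beta>" "\<beta> < 1" and a: "0 < a" "a \<le> \<beta>" and F: "cone_density \<beta> F"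
  shows "cone_density \<beta> (transfer a F)"
proof -
  let ?K = "12 / (1 - \<beta>)"
  have a': "0 \<le> a" "a \<le> 1" using a b by auto
  have F': "decr F" "integrable unit_leb F" "(\<integral>x. F x \<partial>unit_leb) = 1"
    and Fb: "\<And>x. 0 < x \<Longrightarrow> x < 1 \<Longrightarrow> F x \<le> ?K * x powr (- \<beta>)"
    using F by (auto simp: cone_density_def)
  have "transfer a F x \<le> ?K * x powr (- \<beta>)" if x: "0 < x" "x < 1" for x
  proof -
    define y u w z where "y = linv a x" and "u = (2 * y) powr a" and "w = lweight a x" and "z = (x + 1) / 2"
    have y: "0 < y" "y < 1/2" "x \<le> 2 * y"
      using linv_pos[of a x] linv_less_half[of a x] linv_ge_half[of a x] x a' by (auto simp: y_def)
    \<comment> \<open>Two monotonicities: \<open>x \<le> 2 * y\<close>, and lowering the exponent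
      from \<beta> to \<open>a\<close> increases a power of \<open>2 * y \<le> 1\<close>.\<close>
    have u0: "x powr \<beta> \<le> u"
    proof -
      have "x powr \<beta> \<le> (2 * y) powr \<beta>" using y x b by (intro powr_mono2) auto
      also have "\<dots> \<le> u" unfolding u_def using y a by (intro powr_mono') auto
      finally show ?thesis .
    qed
    have u1: "u \<le> 1" unfolding u_def using y a by (intro powr_le1) auto
    have u2: "0 \<le> u" unfolding u_def by simp
    have w: "w = 1 / (1 + (1 + a) * u)" unfolding w_def u_def y_def lweight_def by simp
    have den: "0 < 1 + (1 + a) * u" using a u2 by (intro add_pos_nonneg) auto
    have xy: "x = y * (1 + u)" using linv_eq[of a x] x a' unfolding u_def y_def by simp
    \<comment> \<open>Bounding \<open>s * q\<close> by \<open>2 * s\<close> shows that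
      \<open>(1 - s / 3) * (1 + q)\<close> is at least
      \<open>1 + q - s = 1 + (a + \<beta>) * u\<close>.\<close>
    define q s where "q = (1 + a) * u" and "s = (1 - \<beta>) * u"
    have "q \<le> 2 * 1" unfolding q_def using a' u1 u2 by (intro mult_mono) auto
    then have "s * q \<le> s * 2" using b u2 by (intro mult_left_mono) (auto simp: s_def)
    moreover have "(1 - s / 3) * (1 + q) = 1 + q - s / 3 - s * q / 3" by (simp add: algebra_simps)
    moreover have "0 \<le> a * u" using a u2 by auto
    moreover have "q - s = a * u + \<beta> * u" by (simp add: q_def s_def algebra_simps)
    ultimately have "1 + \<beta> * u \<le> (1 - s / 3) * (1 + q)" by linarith
    then have "1 + \<beta> * u \<le> (1 - (1 - \<beta>) * u / 3) * (1 + (1 + a) * u)"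
      by (simp add: q_def s_def)
    then have "(1 + u) powr \<beta> \<le> (1 - (1 - \<beta>) * u / 3) * (1 + (1 + a) * u)"
      using powr_one_plus_le[of \<beta> u] b u2 by simp
    then have *: "(1 + u) powr \<beta> * w \<le> 1 - (1 - \<beta>) * u / 3"
      unfolding w using den by (simp add: pos_divide_le_eq)
    have "x powr \<beta> = y powr \<beta> * (1 + u) powr \<beta>" using xy y u2 by (simp add: powr_mult)
    then have yp: "y powr (- \<beta>) = x powr (- \<beta>) * (1 + u) powr \<beta>"
      using x y u2 by (simp add: powr_minus field_simps)
    have "F z \<le> 2"
    proof -
      have z: "1/2 < z" "z < 1" using x by (auto simp: z_def)
      have "F z * (1/2) \<le> F z * z" using z decr_nonneg[OF F'(1), of z] by (intro mult_left_mono) auto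
      also have "\<dots> \<le> 1" using decr_le_inverse[OF F'(1,2), of z] F'(3) z by (simp add: mult.commute)
      finally show ?thesis by simp
    qed
    moreover have "F y * w \<le> ?K * x powr (- \<beta>) - 4"
    proof -
      have "F y * w \<le> ?K * y powr (- \<beta>) * w"
        using Fb[of y] y den w by (intro mult_right_mono) auto
      also have "\<dots> = ?K * x powr (- \<beta>) * ((1 + u) powr \<beta> * w)" by (simp add: yp)
      also have "\<dots> \<le> ?K * x powr (- \<beta>) * (1 - (1 - \<beta>) * u / 3)"
        using * b by (intro mult_left_mono) auto
      also have "\<dots> = ?K * x powr (- \<beta>) - 4 * (x powr (- \<beta>) * u)"
        using b by (simp add: field_simps)
      also have "x powr (- \<beta>) * u \<ge> x powr (- \<beta>) * x powr \<beta>" using u0 by (intro mult_left_mono) auto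
      then have "x powr (- \<beta>) * u \<ge> 1" using x by (simp add: powr_minus)
      then have "?K * x powr (- \<beta>) - 4 * (x powr (- \<beta>) * u) \<le> ?K * x powr (- \<beta>) - 4" by simp
      finally show ?thesis .
    qed
    ultimately show ?thesis unfolding transfer_def y_def[symmetric] w_def[symmetric] z_def[symmetric] by simp
  qed
  then show ?thesis
    using transfer_decr[OF a' F'(1)] transfer_integral[OF a' F'(2)] F'(3)
    by (auto simp: cone_density_def)
qed

text \<open>One factor \<open>1 / (1 - \<beta>)\<close> belongs to the pole constant, the other
  comes from integrating \<open>x powr (- \<beta>)\<close>.\<close>

lemma cone_density_mass_near_0:
  assumes b: "0 < \<beta>" "\<beta> < 1" and F: "cone_density \<beta> F" and e: "0 < e" "e \<le> 1"
  shows "(\<integral>x. (if x < e then F x else 0) \<partial>unit_leb) \<le> 12 / (1 - \<beta>)\<^sup>2 * e powr (1 - \<beta>)"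
proof -
  let ?K = "12 / (1 - \<beta>)"
  have "((\<lambda>x. x powr (- \<beta>)) has_integral (e powr (- \<beta> + 1) / (- \<beta> + 1))) {0..e}"
    using has_integral_powr_from_0[of "- \<beta>" e] b e by simp
  then have hi: "((\<lambda>x. x powr (- \<beta>)) has_integral (e powr (1 - \<beta>) / (1 - \<beta>))) {0<..<e}"
    by (simp add: has_integral_Icc_iff_Ioo)
  then have ai: "(\<lambda>x. x powr (- \<beta>)) absolutely_integrable_on {0<..<e}"
    by (intro nonnegative_absolutely_integrable_1) (auto simp: has_integral_integrable)
  have eq: "(\<lambda>x. indicator {0<..<e} x *\<^sub>R x powr (- \<beta>)) =
      (\<lambda>x. indicator {0<..<1} x *\<^sub>R (if x < e then x powr (- \<beta>) else 0))"
    using e by (auto simp: indicator_def fun_eq_iff)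
  have ai1: "integrable unit_leb (\<lambda>x. if x < e then x powr (- \<beta>) else 0)"
    using ai unfolding integrable_lebesgue_on_iff[OF lmeasurable_open[OF bounded_Ioo open_greaterThanLessThan, THEN fmeasurableD]]
      set_integrable_def eq .
  have "(\<integral>x. (if x < e then x powr (- \<beta>) else 0) \<partial>unit_leb) = (\<integral>x. x powr (- \<beta>) \<partial>lebesgue_on {0<..<e})"
    using eq by (simp add: integral_restrict_space)
  also have "\<dots> = e powr (1 - \<beta>) / (1 - \<beta>)"
    using hi ai by (subst lebesgue_integral_eq_integral) (auto simp: integrable_lebesgue_on_iff)
  finally have val: "(\<integral>x. (if x < e then x powr (- \<beta>) else 0) \<partial>unit_leb) = e powr (1 - \<beta>) / (1 - \<beta>)" .
  have "(\<integral>x. (if x < e then F x else 0) \<partial>unit_leb) \<le> (\<integral>x. ?K * (if x < e then x powr (- \<beta>) else 0) \<partial>unit_leb)"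
    using F ai1 by (intro unit_integral_mono) (auto simp: cone_density_def intro!: unit_integrable_if)
  also have "\<dots> = 12 / (1 - \<beta>)\<^sup>2 * e powr (1 - \<beta>)"
    using val by (simp add: power2_eq_square)
  finally show ?thesis .
qed

lemma cone_density_const_1:
  assumes "0 < \<beta>" "\<beta> < 1" shows "cone_density \<beta> (\<lambda>_. 1)"
proof -
  have "1 \<le> 12 / (1 - \<beta>) * x powr (- \<beta>)" if "0 < x" "x < 1" for x :: real
  proof -
    have "x powr \<beta> \<le> 1" using that assms by (intro powr_le1) auto
    then have "1 \<le> x powr (- \<beta>)" using that by (simp add: powr_minus divide_simps)
    then have "1 * 1 \<le> 12 / (1 - \<beta>) * x powr (- \<beta>)" using assms by (intro mult_mono) auto
    then show ?thesis by simp
  qed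
  then show ?thesis unfolding cone_density_def using unit_integral_const[of 1]
    by (simp only: decr_const unit_integrable_const) auto
qed

section \<open>Lower bounds for iterated transfer operators\<close>

text \<open>The newest map is inverted first, so the value is the point that follows left branches
  for \<open>n\<close> steps and ends at \<open>z\<close>; \<open>linv_iter \<alpha> j 1\<close> is
  the point \<open>x\<^sub>j\<close> of the overview.\<close>

primrec linv_iter :: "(nat \<Rightarrow> real) \<Rightarrow> nat \<Rightarrow> real \<Rightarrow> real" where
  "linv_iter \<alpha> 0 z = z"
| "linv_iter \<alpha> (Suc n) z = linv_iter \<alpha> n (linv (\<alpha> (Suc n)) z)"

text \<open>The derivative of \<open>linv_iter \<alpha> n\<close> at \<open>z\<close>, by the chain
  rule.\<close>

primrec linv_iter_weight :: "(nat \<Rightarrow> real) \<Rightarrow> nat \<Rightarrow> real \<Rightarrow> real" where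
  "linv_iter_weight \<alpha> 0 z = 1"
| "linv_iter_weight \<alpha> (Suc n) z = linv_iter_weight \<alpha> n (linv (\<alpha> (Suc n)) z) * lweight (\<alpha> (Suc n)) z"

text \<open>The factor 1/4 is a product of two halves: \<open>ln (1 + s) \<ge> s / 2\<close> on
  [0, 1], and \<open>exp (- v) \<le> 1 - v / 2\<close> on [0, 1/2].\<close>

lemma powr_minus_one_plus_le:
  fixes s :: real
  assumes "0 < b" "b < 1" "0 \<le> s" "s \<le> 1"
  shows "(1 + s) powr (- b) \<le> 1 - b / 4 * s"
proof -
  have "s / 2 \<le> ln (1 + s)"
  proof -
    have "1 - 1 / (1 + s) \<le> ln (1 + s)"
      using ln_le_minus_one[of "1 / (1 + s)"] assms by (simp add: ln_div)
    moreover have "s / 2 \<le> 1 - 1 / (1 + s)"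
    proof -
      have "s * s \<le> s * 1" using assms by (intro mult_left_mono) auto
      then show ?thesis using assms by (simp add: field_simps)
    qed
    ultimately show ?thesis by simp
  qed
  then have "b * (s / 2) \<le> b * ln (1 + s)" using assms by (intro mult_left_mono) auto
  then have "(1 + s) powr (- b) \<le> exp (- (b * s / 2))"
    using assms by (simp add: powr_def)
  also have "\<dots> \<le> 1 - b / 4 * s"
  proof -
    define v where "v = b * s / 2"
    have "b * s \<le> 1 * 1" using assms by (intro mult_mono) auto
    then have v: "0 \<le> v" "v \<le> 1/2" using assms by (auto simp: v_def)
    have "1 + v \<le> exp v" by simp
    then have "exp (- v) \<le> 1 / (1 + v)" using v by (simp add: exp_minus divide_simps)
    also have "\<dots> \<le> 1 - v / 2"
    proof -
      have "v * v \<le> v * 1" using v by (intro mult_left_mono) auto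
      then show ?thesis using v by (simp add: field_simps)
    qed
    finally show ?thesis by (simp add: v_def)
  qed
  finally show ?thesis .
qed

text \<open>In the coordinate \<open>z powr (- \<beta>)\<close> the slow motion near the neutral
  fixed point becomes linear: each inverse step adds at least a fixed amount, whatever the parameter
  \<open>a \<le> \<beta>\<close>.\<close>

lemma linv_decay:
  assumes b: "0 < \<beta>" "\<beta> < 1" and a: "0 < a" "a \<le> \<beta>" and z: "0 < z" "z \<le> 1"
  shows "z powr (- \<beta>) + \<beta> / 4 \<le> linv a z powr (- \<beta>)"
proof -
  define y where "y = linv a z"
  have y: "0 < y" "y \<le> 1/2" using linv_pos[of a z] linv_le_half[of a z] a z by (auto simp: y_def)
  have "y powr \<beta> \<le> (2 * y) powr \<beta>" using y b by (intro powr_mono2) auto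
  also have "\<dots> \<le> (2 * y) powr a" using y a by (intro powr_mono') auto
  finally have "y * (1 + y powr \<beta>) \<le> y * (1 + (2 * y) powr a)" using y by (intro mult_left_mono) auto
  then have "y * (1 + y powr \<beta>) \<le> z" using linv_eq[of a z] a z by (simp add: y_def)
  then have "z powr (- \<beta>) \<le> (y * (1 + y powr \<beta>)) powr (- \<beta>)"
    using y b by (intro powr_mono2') (auto intro!: mult_pos_pos add_pos_nonneg)
  also have "\<dots> = y powr (- \<beta>) * (1 + y powr \<beta>) powr (- \<beta>)"
    using y by (simp add: powr_mult)
  also have "\<dots> \<le> y powr (- \<beta>) * (1 - \<beta> / 4 * y powr \<beta>)"
    using y b by (intro mult_left_mono powr_minus_one_plus_le powr_le1) auto
  also have "\<dots> = y powr (- \<beta>) - \<beta> / 4" using y by (simp add: algebra_simps powr_minus)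
  finally show ?thesis by (simp add: y_def)
qed

context pm_sequence
begin

lemma iter_cone_density: "cone_density \<beta> F \<Longrightarrow> cone_density \<beta> (transfer_iter \<alpha> n F)"
  by (induction n) (auto intro!: transfer_cone_density beta alpha)

lemma linv_iter_range:
  assumes "0 < z" "z \<le> 1"
  shows "0 < linv_iter \<alpha> n z" "linv_iter \<alpha> n z \<le> z"
proof -
  have "0 < linv_iter \<alpha> n z \<and> linv_iter \<alpha> n z \<le> z"
    using assms
  proof (induction n arbitrary: z)
    case (Suc n)
    let ?y = "linv (\<alpha> (Suc n)) z"
    have "0 < ?y" "?y \<le> z" using linv_pos[of "\<alpha> (Suc n)" z] linv_le[of "\<alpha> (Suc n)" z] Suc.prems alpha by auto
    then show ?case using Suc.IH[of ?y] Suc.prems by auto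
  qed auto
  then show "0 < linv_iter \<alpha> n z" "linv_iter \<alpha> n z \<le> z" by auto
qed

lemma linv_range:
  assumes "0 < z" "z \<le> 1"
  shows "0 < linv (\<alpha> (Suc n)) z" "linv (\<alpha> (Suc n)) z \<le> 1" "linv (\<alpha> (Suc n)) z \<le> 1/2"
  using linv_pos[of "\<alpha> (Suc n)" z] linv_le_half[of "\<alpha> (Suc n)" z] assms alpha by auto

lemma linv_iter_Suc_le_half: "0 < z \<Longrightarrow> z \<le> 1 \<Longrightarrow> linv_iter \<alpha> (Suc n) z \<le> 1/2"
  using linv_iter_range(2)[of "linv (\<alpha> (Suc n)) z" n] linv_range[of z n] by auto

lemma linv_iter_mono: "0 < z \<Longrightarrow> z \<le> z' \<Longrightarrow> z' \<le> 1 \<Longrightarrow> linv_iter \<alpha> n z \<le> linv_iter \<alpha> n z'"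
proof (induction n arbitrary: z z')
  case (Suc n)
  then show ?case using linv_range[of z n] linv_range[of z' n]
    by (auto intro!: Suc.IH linv_mono alpha)
qed auto

lemma linv_iter_weight_ge: "0 < z \<Longrightarrow> z \<le> 1 \<Longrightarrow> (1/3) ^ n \<le> linv_iter_weight \<alpha> n z"
proof (induction n arbitrary: z)
  case (Suc n)
  have "(1/3) ^ n * (1/3) \<le> linv_iter_weight \<alpha> n (linv (\<alpha> (Suc n)) z) * lweight (\<alpha> (Suc n)) z"
    using Suc.prems linv_range[of z n] lweight_bounds[of "\<alpha> (Suc n)" z] alpha
    by (intro mult_mono Suc.IH) (auto intro: order.trans[OF _ Suc.IH])
  then show ?case by simp
qed auto

lemma linv_iter_weight_nonneg: "0 < z \<Longrightarrow> z \<le> 1 \<Longrightarrow> 0 \<le> linv_iter_weight \<alpha> n z"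
  using linv_iter_weight_ge[of z n] by (meson order.trans zero_le_power zero_le_divide_1_iff zero_le_numeral)

lemma linv_iter_weight_antimono:
  "0 < z \<Longrightarrow> z \<le> z' \<Longrightarrow> z' \<le> 1 \<Longrightarrow> linv_iter_weight \<alpha> n z' \<le> linv_iter_weight \<alpha> n z"
proof (induction n arbitrary: z z')
  case (Suc n)
  then show ?case using linv_range[of z n] linv_range[of z' n] lweight_bounds[of "\<alpha> (Suc n)" z'] alpha
    by (auto intro!: mult_mono Suc.IH linv_mono lweight_antimono linv_iter_weight_nonneg)
qed auto

text \<open>Compositions of left inverses are increasing and concave, so the derivative at the left
  end dominates the secant slope.\<close>

lemma linv_iter_diff_le:
  "0 < z \<Longrightarrow> z \<le> z' \<Longrightarrow> z' \<le> 1 \<Longrightarrow> linv_iter \<alpha> n z' - linv_iter \<alpha> n z \<le> (z' - z) * linv_iter_weight \<alpha> n z"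
proof (induction n arbitrary: z z')
  case (Suc n)
  let ?y = "linv (\<alpha> (Suc n)) z" and ?y' = "linv (\<alpha> (Suc n)) z'"
  have y: "0 < ?y" "?y \<le> ?y'" "?y' \<le> 1" "?y \<le> 1"
    using Suc.prems linv_range[of z n] linv_range[of z' n] by (auto intro!: linv_mono alpha)
  have "?y' - ?y \<le> (z' - z) * lweight (\<alpha> (Suc n)) z"
    using linv_diff_le[of "\<alpha> (Suc n)" z z'] Suc.prems alpha by auto
  then have "(?y' - ?y) * linv_iter_weight \<alpha> n ?y \<le> (z' - z) * lweight (\<alpha> (Suc n)) z * linv_iter_weight \<alpha> n ?y"
    using y by (intro mult_right_mono linv_iter_weight_nonneg) auto
  moreover have "linv_iter \<alpha> n ?y' - linv_iter \<alpha> n ?y \<le> (?y' - ?y) * linv_iter_weight \<alpha> n ?y"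
    using Suc.IH y by auto
  ultimately show ?case by (simp add: mult_ac)
qed auto

lemma linv_iter_decay:
  "0 < z \<Longrightarrow> z \<le> 1 \<Longrightarrow> z powr (- \<beta>) + \<beta> / 4 * real n \<le> linv_iter \<alpha> n z powr (- \<beta>)"
proof (induction n arbitrary: z)
  case (Suc n)
  have "z powr (- \<beta>) + \<beta> / 4 \<le> linv (\<alpha> (Suc n)) z powr (- \<beta>)"
    using Suc.prems linv_decay[OF beta] alpha by auto
  moreover have "linv (\<alpha> (Suc n)) z powr (- \<beta>) + \<beta> / 4 * real n \<le> linv_iter \<alpha> (Suc n) z powr (- \<beta>)"
    using Suc.IH[of "linv (\<alpha> (Suc n)) z"] linv_range[of z n] Suc.prems by simp
  ultimately show ?case by (simp add: field_simps)
qed auto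

lemma linv_iter_1_le: "linv_iter \<alpha> n 1 \<le> (1 + \<beta> / 4 * real n) powr (- 1 / \<beta>)"
proof -
  have "1 + \<beta> / 4 * real n \<le> linv_iter \<alpha> n 1 powr (- \<beta>)" using linv_iter_decay[of 1 n] by simp
  then have "(linv_iter \<alpha> n 1 powr (- \<beta>)) powr (- 1 / \<beta>) \<le> (1 + \<beta> / 4 * real n) powr (- 1 / \<beta>)"
    using beta by (intro powr_mono2') (auto intro: add_pos_nonneg)
  then show ?thesis using linv_iter_range(1)[of 1 n] beta by (simp add: powr_powr)
qed

text \<open>The interval between the two points is the image of [1/2, 1] under \<open>j\<close>
  inverse branches, whose derivative is largest at 1/2. Since \<open>linv\<close> sends 1 to 1/2,
  this largest value is itself a factor of the weight at 1 for \<open>j + 1\<close> steps, and the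
  other factor is at least 1/3. No distortion estimate enters.\<close>

lemma linv_iter_gap:
  "2 * (linv_iter \<alpha> j 1 - linv_iter \<alpha> (Suc j) 1) \<le> 3 * linv_iter_weight \<alpha> (Suc j) 1"
proof -
  let ?a = "\<alpha> (Suc j)" and ?W = "linv_iter_weight \<alpha> j (1/2)"
  have h: "linv ?a 1 = 1/2" using linv_1 alpha by simp
  have "linv_iter \<alpha> j 1 - linv_iter \<alpha> j (1/2) \<le> (1 - 1/2) * ?W"
    by (rule linv_iter_diff_le) auto
  moreover have "?W * (1/3) \<le> ?W * lweight ?a 1"
    using lweight_bounds[of ?a 1] alpha[of j] linv_iter_weight_nonneg[of "1/2" j] by (intro mult_left_mono) auto
  moreover have "linv_iter_weight \<alpha> (Suc j) 1 = ?W * lweight ?a 1" "linv_iter \<alpha> (Suc j) 1 = linv_iter \<alpha> j (1/2)"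
    by (simp_all only: linv_iter.simps linv_iter_weight.simps h)
  ultimately show ?thesis by (simp del: linv_iter.simps linv_iter_weight.simps)
qed

end

lemma transfer_sum: "transfer a (\<lambda>x. \<Sum>j\<in>A. c j * g j x) x = (\<Sum>j\<in>A. c j * transfer a (g j) x)"
  by (simp add: transfer_def sum_distrib_left sum_distrib_right sum_divide_distrib sum.distrib[symmetric] algebra_simps)

context pm_sequence
begin

text \<open>A crude bound from the left branch alone, good enough for boundedly many steps.\<close>

lemma iter_one_ge: "0 < x \<Longrightarrow> x < 1 \<Longrightarrow> (1/3) ^ n \<le> transfer_iter \<alpha> n (\<lambda>_. 1) x"
proof (induction n arbitrary: x)
  case (Suc n)
  let ?a = "\<alpha> (Suc n)"
  have "(1/3) ^ n * (1/3) \<le> (1/3) ^ n * lweight ?a x + (1/3) ^ n / (2::real)"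
    using lweight_bounds[of ?a x] alpha[of n] Suc.prems
    by (intro add_increasing2 mult_left_mono) auto
  also have "\<dots> = transfer ?a (\<lambda>_. (1/3) ^ n) x" by (simp add: transfer_def)
  also have "\<dots> \<le> transfer ?a (transfer_iter \<alpha> n (\<lambda>_. 1)) x"
    using Suc by (intro transfer_mono alpha) auto
  finally show ?case by simp
qed auto

text \<open>Only the orbits that stay on left branches for some time \<open>j\<close> and then leave through the
  right branch are kept.\<close>

lemma iter_lower:
  assumes f: "decr f" and x: "0 < x" "x < 1"
  shows "f (linv_iter \<alpha> n x) * linv_iter_weight \<alpha> n x
      + (\<Sum>j\<in>{1..<n}. f (linv_iter \<alpha> j 1) * linv_iter_weight \<alpha> j 1 / 2 *
          transfer_iter (shift (Suc j) \<alpha>) (n - Suc j) (\<lambda>_. 1) x)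
    \<le> transfer_iter \<alpha> n f x"
  using x
proof (induction n arbitrary: x)
  case (Suc n)
  let ?a = "\<alpha> (Suc n)" and ?y = "(x + 1) / 2"
  let ?c = "\<lambda>j. f (linv_iter \<alpha> j 1) * linv_iter_weight \<alpha> j 1 / 2"
  let ?g = "\<lambda>n j. transfer_iter (shift (Suc j) \<alpha>) (n - Suc j) (\<lambda>_. 1)"
  let ?B = "\<lambda>n x. f (linv_iter \<alpha> n x) * linv_iter_weight \<alpha> n x"
  have y: "0 < ?y" "?y \<le> 1" "?y < 1" using Suc.prems by auto
  have B0: "0 \<le> ?B n ?y"
    using y linv_iter_range[of ?y n] by (intro mult_nonneg_nonneg decr_nonneg[OF f] linv_iter_weight_nonneg) auto
  \<comment> \<open>The new exit term \<open>j = n\<close>: the right preimage \<open>?y\<close> is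
    below 1, and both \<open>f\<close> along the left branches and the weight are decreasing in it.
    There is no term \<open>j = 0\<close>, as \<open>linv_iter \<alpha> 0 1 = 1\<close> lies outside
    the interval controlled by \<open>decr\<close>.\<close>
  have Bn: "?c n \<le> ?B n ?y / 2" if n: "0 < n"
  proof -
    obtain m where "n = Suc m" using n by (cases n) auto
    then have "linv_iter \<alpha> n 1 < 1" using linv_iter_Suc_le_half[of 1 m] by simp
    then show ?thesis
      using y linv_iter_range[of ?y n] linv_iter_mono[of ?y 1 n] linv_iter_weight_antimono[of ?y 1 n] linv_iter_weight_nonneg[of 1 n]
      by (intro divide_right_mono mult_mono decrD[OF f] decr_nonneg[OF f]) auto
  qed
  have tg: "transfer ?a (?g n j) x = ?g (Suc n) j x" if "j \<in> {1..<n}" for j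
  proof -
    have "Suc n - Suc j = Suc (n - Suc j)" using that by auto
    moreover have "shift (Suc j) \<alpha> (Suc (n - Suc j)) = ?a" using that by (simp add: shift_def)
    ultimately show ?thesis by simp
  qed
  have sum: "(\<Sum>j\<in>{1..<Suc n}. ?c j * ?g (Suc n) j x) \<le> ?B n ?y / 2 + (\<Sum>j\<in>{1..<n}. ?c j * ?g (Suc n) j x)"
    using Bn B0 by (cases "n = 0") (auto simp: sum.atLeastLessThan_Suc)
  have "?B (Suc n) x + (\<Sum>j\<in>{1..<Suc n}. ?c j * ?g (Suc n) j x)
      \<le> ?B n (linv ?a x) * lweight ?a x + ?B n ?y / 2 + (\<Sum>j\<in>{1..<n}. ?c j * transfer ?a (?g n j) x)"
    using sum tg by simp
  also have "\<dots> = transfer ?a (\<lambda>x. ?B n x + (\<Sum>j\<in>{1..<n}. ?c j * ?g n j x)) x"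
    unfolding transfer_linear(1) transfer_sum[where g = "?g n"] by (simp add: transfer_def)
  also have "\<dots> \<le> transfer ?a (transfer_iter \<alpha> n f) x"
    using Suc by (intro transfer_mono alpha) auto
  finally show ?case by simp
qed auto

text \<open>Between consecutive points of the backward orbit of 1, a decreasing \<open>f\<close> is
  at most its value at the left one, and this is the value that occurs in
  \<open>iter_lower\<close>.\<close>

lemma integral_le_liter_sum:
  assumes f: "decr f" "integrable unit_leb f"
  shows "(\<integral>x. (if linv_iter \<alpha> m 1 \<le> x then f x else 0) \<partial>unit_leb)
    \<le> (\<Sum>j<m. f (linv_iter \<alpha> (Suc j) 1) * (linv_iter \<alpha> j 1 - linv_iter \<alpha> (Suc j) 1))"
proof (induction m)
  case 0
  have "(\<integral>x. (if 1 \<le> x then f x else 0) \<partial>unit_leb) = (\<integral>x. 0 \<partial>unit_leb)"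
    by (intro unit_integral_cong) auto
  then show ?case by simp
next
  case (Suc m)
  let ?s = "linv_iter \<alpha> (Suc m) 1" and ?t = "linv_iter \<alpha> m 1"
  have st: "0 < ?s" "?s \<le> ?t" "?t \<le> 1" "?s < 1"
    using linv_iter_range[of 1 "Suc m"] linv_iter_range[of 1 m] linv_iter_Suc_le_half[of 1 m]
      linv_iter_mono[of "linv (\<alpha> (Suc m)) 1" 1 m] linv_range[of 1 m] by auto
  have i: "integrable unit_leb (\<lambda>x. if ?s \<le> x then f x else 0)"
    "integrable unit_leb (\<lambda>x. if ?t \<le> x then f x else 0)"
    "integrable unit_leb (\<lambda>x. if ?s \<le> x \<and> x < ?t then f ?s else 0)"
    using f st by (auto intro!: unit_integrable_if unit_integral_step simp del: linv_iter.simps)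
  have "(\<integral>x. (if ?s \<le> x then f x else 0) \<partial>unit_leb) \<le>
    (\<integral>x. (if ?t \<le> x then f x else 0) + (if ?s \<le> x \<and> x < ?t then f ?s else 0) \<partial>unit_leb)"
    using i st decrD[OF f(1)] decr_nonneg[OF f(1)]
    by (intro unit_integral_mono Bochner_Integration.integrable_add) (auto simp del: linv_iter.simps)
  also have "\<dots> = (\<integral>x. (if ?t \<le> x then f x else 0) \<partial>unit_leb) + f ?s * (?t - ?s)"
    using i st unit_integral_step(2)[of ?s ?t "f ?s"] by (subst Bochner_Integration.integral_add) auto
  finally show ?case using Suc.IH by simp
qed

text \<open>Since \<open>f\<close> is constant on \<open>(0, e)\<close> and
  \<open>x\<^sub>m \<le> e / 2\<close>, no more mass lies below \<open>x\<^sub>m\<close> than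
  between \<open>x\<^sub>m\<close> and \<open>e\<close>, so at least half of the mass lies above
  \<open>x\<^sub>m\<close>. The constant 1/6 is this half, times 1/2 for the inverse slope of the
  right branch, times 2/3 from \<open>linv_iter_gap\<close>.\<close>

lemma iter_ge_mean:
  assumes f: "decr f" "integrable unit_leb f"
    and \<gamma>: "0 \<le> \<gamma>" "\<And>m n x. 0 < x \<Longrightarrow> x < 1 \<Longrightarrow> \<gamma> \<le> transfer_iter (shift m \<alpha>) n (\<lambda>_. 1) x"
    and e: "0 < e" "e < 1" "\<And>x. 0 < x \<Longrightarrow> x < e \<Longrightarrow> f x = f e" "linv_iter \<alpha> m 1 \<le> e / 2"
    and x: "0 < x" "x < 1"
  shows "\<gamma> / 6 * (\<integral>x. f x \<partial>unit_leb) \<le> transfer_iter \<alpha> (Suc m) f x"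
proof -
  let ?s = "linv_iter \<alpha> m 1"
  have s: "0 < ?s" "?s \<le> e" "?s < 1" using linv_iter_range[of 1 m] e by auto
  let ?S = "\<integral>x. (if ?s \<le> x then f x else 0) \<partial>unit_leb"
  have fe: "0 \<le> f e" using e decr_nonneg f by auto
  have "f e * (e - ?s) = (\<integral>x. (if ?s \<le> x \<and> x < e then f e else 0) \<partial>unit_leb)"
    using s e unit_integral_step(2)[of ?s e "f e"] by simp
  also have "\<dots> \<le> ?S"
    using s e fe decr_nonneg[OF f(1)]
    by (intro unit_integral_mono unit_integrable_if unit_integral_step f) auto
  finally have 1: "f e * (e - ?s) \<le> ?S" .
  have "(\<integral>x. f x \<partial>unit_leb) = (\<integral>x. (if ?s \<le> x then f x else 0) + (if 0 \<le> x \<and> x < ?s then f e else 0) \<partial>unit_leb)"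
    using s e by (intro unit_integral_cong) auto
  also have "\<dots> = ?S + f e * ?s"
    using s e f unit_integral_step[of 0 ?s "f e"] by (subst Bochner_Integration.integral_add) (auto intro!: unit_integrable_if)
  also have "f e * ?s \<le> f e * (e - ?s)" using fe e by (intro mult_left_mono) auto
  finally have 2: "(\<integral>x. f x \<partial>unit_leb) \<le> 2 * ?S" using 1 by simp
  have "\<gamma> / 6 * (\<integral>x. f x \<partial>unit_leb) \<le> \<gamma> / 6 * (2 * ?S)"
    using 2 \<gamma> by (intro mult_left_mono) auto
  also have "\<dots> = \<gamma> / 3 * ?S" by simp
  also have "\<dots> \<le> \<gamma> / 3 * (\<Sum>j<m. f (linv_iter \<alpha> (Suc j) 1) * (linv_iter \<alpha> j 1 - linv_iter \<alpha> (Suc j) 1))"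
    using integral_le_liter_sum[OF f] \<gamma> by (intro mult_left_mono) auto
  also have "\<dots> = (\<Sum>j<m. f (linv_iter \<alpha> (Suc j) 1) * (2 * (linv_iter \<alpha> j 1 - linv_iter \<alpha> (Suc j) 1)) / 6 * \<gamma>)"
    unfolding sum_distrib_left by (intro sum.cong) (simp_all add: algebra_simps del: linv_iter.simps)
  also have "\<dots> \<le> (\<Sum>j<m. f (linv_iter \<alpha> (Suc j) 1) * (3 * linv_iter_weight \<alpha> (Suc j) 1) / 6 *
      transfer_iter (shift (Suc (Suc j)) \<alpha>) (Suc m - Suc (Suc j)) (\<lambda>_. 1) x)"
  proof (rule sum_mono)
    fix j
    have l: "0 < linv_iter \<alpha> (Suc j) 1" "linv_iter \<alpha> (Suc j) 1 < 1"
      using linv_iter_range[of 1 "Suc j"] linv_iter_Suc_le_half[of 1 j] by auto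
    have "f (linv_iter \<alpha> (Suc j) 1) * (2 * (linv_iter \<alpha> j 1 - linv_iter \<alpha> (Suc j) 1))
        \<le> f (linv_iter \<alpha> (Suc j) 1) * (3 * linv_iter_weight \<alpha> (Suc j) 1)"
      by (rule mult_left_mono[OF linv_iter_gap decr_nonneg[OF f(1) l]])
    moreover have "0 \<le> f (linv_iter \<alpha> (Suc j) 1) * (3 * linv_iter_weight \<alpha> (Suc j) 1) / 6"
      using decr_nonneg[OF f(1) l] linv_iter_weight_nonneg[of 1 "Suc j"]
      by (simp del: linv_iter.simps linv_iter_weight.simps)
    ultimately show "f (linv_iter \<alpha> (Suc j) 1) * (2 * (linv_iter \<alpha> j 1 - linv_iter \<alpha> (Suc j) 1)) / 6 * \<gamma>
      \<le> f (linv_iter \<alpha> (Suc j) 1) * (3 * linv_iter_weight \<alpha> (Suc j) 1) / 6 *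
        transfer_iter (shift (Suc (Suc j)) \<alpha>) (Suc m - Suc (Suc j)) (\<lambda>_. 1) x"
      using \<gamma>(2)[OF x] by (intro mult_mono[OF divide_right_mono _ _ \<gamma>(1)]) simp_all
  qed
  \<comment> \<open>Leaving from \<open>x\<^sub>m\<close> takes \<open>m\<close> left steps and one
    right step, hence \<open>Suc m\<close> steps in all.\<close>
  also have "\<dots> = (\<Sum>j\<in>{1..<Suc m}. f (linv_iter \<alpha> j 1) * linv_iter_weight \<alpha> j 1 / 2 *
      transfer_iter (shift (Suc j) \<alpha>) (Suc m - Suc j) (\<lambda>_. 1) x)"
    by (rule sum.reindex_bij_witness[of _ "\<lambda>j. j - 1" Suc]) (auto simp del: linv_iter.simps linv_iter_weight.simps)
  also have "\<dots> \<le> transfer_iter \<alpha> (Suc m) f x"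
  proof -
    have "0 \<le> f (linv_iter \<alpha> (Suc m) x) * linv_iter_weight \<alpha> (Suc m) x"
      using x linv_iter_range[of x "Suc m"] by (intro mult_nonneg_nonneg decr_nonneg[OF f(1)] linv_iter_weight_nonneg) auto
    then show ?thesis using iter_lower[OF f(1) x, of "Suc m"] by linarith
  qed
  finally show ?thesis .
qed

end

text \<open>For large \<open>n\<close>, all but the last \<open>Suc J\<close> steps turn 1 into a
  density with the pole bound, which has at most half of its mass below \<open>e\<close> and hence
  is at least 1/2 on \<open>(0, e]\<close>. In the last \<open>Suc J\<close> steps every point has a
  preimage in this region, at the cost of a fixed weight.\<close>

lemma iter_one_uniformly_ge:
  assumes b: "0 < \<beta>" "\<beta> < 1"
  shows "\<exists>\<gamma>>0. \<gamma> \<le> 1 \<and> (\<forall>\<alpha> n x. pm_sequence \<beta> \<alpha> \<longrightarrow> 0 < x \<longrightarrow> x < 1 \<longrightarrow> \<gamma> \<le> transfer_iter \<alpha> n (\<lambda>_. 1) x)"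
proof -
  let ?D = "\<lambda>e. 12 / (1 - \<beta>)\<^sup>2 * e powr (1 - \<beta>)"
  \<comment> \<open>Chosen so that the bound of \<open>cone_density_mass_near_0\<close> equals
    1/2.\<close>
  define e where "e = ((1 - \<beta>)\<^sup>2 / 24) powr (1 / (1 - \<beta>))"
  have sq: "0 < (1 - \<beta>)\<^sup>2" "(1 - \<beta>)\<^sup>2 \<le> 1" using b by (auto simp: power_le_one)
  have "e < 1 powr (1 / (1 - \<beta>))" unfolding e_def using b sq by (intro powr_less_mono2) auto
  moreover have "0 < e" using sq b by (simp add: e_def)
  moreover have "?D e \<le> 1/2" using b sq by (simp add: e_def powr_powr)
  ultimately have e: "?D e \<le> 1/2" "0 < e" "e < 1" by auto
  \<comment> \<open>So many left inverses bring the point 1 below \<open>e\<close>.\<close>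
  obtain J :: nat where "4 / \<beta> * e powr (- \<beta>) \<le> real J" using real_arch_simple by blast
  then have "e powr (- \<beta>) \<le> 1 + \<beta> / 4 * real J" using b by (simp add: field_simps)
  then have "(1 + \<beta> / 4 * real J) powr (- 1 / \<beta>) \<le> (e powr (- \<beta>)) powr (- 1 / \<beta>)"
    using b e by (intro powr_mono2') auto
  then have J: "(1 + \<beta> / 4 * real J) powr (- 1 / \<beta>) \<le> e" using b e by (simp add: powr_powr)
  define \<gamma> :: real where "\<gamma> = (1/3) ^ Suc J / 4"
  have "\<gamma> \<le> transfer_iter \<alpha> n (\<lambda>_. 1) x" if pm: "pm_sequence \<beta> \<alpha>" and x: "0 < x" "x < 1" for \<alpha> n x
  proof (cases "n < Suc J")
    case True
    have "\<gamma> \<le> (1/3) ^ Suc J" unfolding \<gamma>_def by simp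
    also have "\<dots> \<le> (1/3) ^ n" using True by (intro power_decreasing) auto
    also have "\<dots> \<le> transfer_iter \<alpha> n (\<lambda>_. 1) x" using pm_sequence.iter_one_ge[OF pm x] .
    finally show ?thesis .
  next
    case False
    define m F \<alpha>' where "m = n - Suc J" and "F = transfer_iter \<alpha> m (\<lambda>_. 1)" and "\<alpha>' = shift m \<alpha>"
    interpret s: pm_sequence \<beta> \<alpha>' unfolding \<alpha>'_def by (rule pm_sequence.shift_pm[OF pm])
    have F: "cone_density \<beta> F" unfolding F_def
      by (rule pm_sequence.iter_cone_density[OF pm cone_density_const_1[OF b]])
    then have F': "decr F" "integrable unit_leb F" "(\<integral>x. F x \<partial>unit_leb) = 1" by (auto simp: cone_density_def)
    have "(\<integral>x. F x \<partial>unit_leb) = (\<integral>x. (if x < e then F x else 0) + (if e \<le> x then F x else 0) \<partial>unit_leb)"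
      by (intro unit_integral_cong) auto
    also have "\<dots> = (\<integral>x. (if x < e then F x else 0) \<partial>unit_leb) + (\<integral>x. (if e \<le> x then F x else 0) \<partial>unit_leb)"
      using F' by (intro Bochner_Integration.integral_add unit_integrable_if) auto
    also have "\<dots> \<le> 1/2 + (\<integral>x. F e \<partial>unit_leb)"
    proof (rule add_mono)
      show "(\<integral>x. (if x < e then F x else 0) \<partial>unit_leb) \<le> 1/2"
        using cone_density_mass_near_0[OF b F, of e] e by simp
      show "(\<integral>x. (if e \<le> x then F x else 0) \<partial>unit_leb) \<le> (\<integral>x. F e \<partial>unit_leb)"
        using e decrD[OF F'(1)] decr_nonneg[OF F'(1)]
        by (intro unit_integral_mono unit_integrable_if F') auto
    qed
    finally have Fe: "1/2 \<le> F e" unfolding F'(3) unit_integral_const by simp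
    \<comment> \<open>One right inverse and then \<open>J\<close> left ones: the slope 1/2 of the
      former, the value 1/2 of \<open>F\<close> and the weight of the latter combine to
      \<open>(1/3) ^ J / 4\<close>.\<close>
    let ?y = "(x + 1) / 2"
    have y: "0 < ?y" "?y < 1" using x by auto
    have l: "0 < linv_iter \<alpha>' J ?y" "linv_iter \<alpha>' J ?y \<le> e"
      using s.linv_iter_range[of ?y J] y s.linv_iter_mono[of ?y 1 J] s.linv_iter_1_le[of J] J by auto
    have "\<gamma> \<le> 1/2 * (1/3) ^ J / 2" unfolding \<gamma>_def by simp
    also have "\<dots> \<le> F (linv_iter \<alpha>' J ?y) * linv_iter_weight \<alpha>' J ?y / 2"
      using Fe l e y decrD[OF F'(1), of "linv_iter \<alpha>' J ?y" e]
      by (intro divide_right_mono mult_mono s.linv_iter_weight_ge) auto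
    also have "\<dots> \<le> transfer_iter \<alpha>' J F ?y / 2"
    proof -
      have "0 \<le> (\<Sum>j\<in>{1..<J}. F (linv_iter \<alpha>' j 1) * linv_iter_weight \<alpha>' j 1 / 2 *
          transfer_iter (shift (Suc j) \<alpha>') (J - Suc j) (\<lambda>_. 1) ?y)"
      proof (intro sum_nonneg mult_nonneg_nonneg divide_nonneg_nonneg)
        fix j assume "j \<in> {1..<J}"
        then obtain i where "j = Suc i" by (cases j) auto
        then show "0 \<le> F (linv_iter \<alpha>' j 1)"
          using s.linv_iter_range[of 1 j] s.linv_iter_Suc_le_half[of 1 i] by (intro decr_nonneg[OF F'(1)]) auto
        show "0 \<le> transfer_iter (shift (Suc j) \<alpha>') (J - Suc j) (\<lambda>_. 1) ?y"
          using decr_nonneg[OF pm_sequence.iter_decr[OF s.shift_pm decr_const] y] by simp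
      qed (auto intro: s.linv_iter_weight_nonneg)
      then show ?thesis using s.iter_lower[OF F'(1) y, of J] by linarith
    qed
    also have "\<dots> \<le> transfer_iter \<alpha>' (Suc J) F x"
    proof -
      let ?a = "\<alpha>' (Suc J)"
      have "0 \<le> transfer_iter \<alpha>' J F (linv ?a x) * lweight ?a x"
        using s.alpha[of J] x linv_unit[of ?a x] lweight_bounds[of ?a x]
        by (intro mult_nonneg_nonneg decr_nonneg[OF s.iter_decr[OF F'(1)]]) auto
      then show ?thesis by (simp add: transfer_def)
    qed
    also have "\<dots> = transfer_iter \<alpha> n (\<lambda>_. 1) x"
      using transfer_iter_add[of \<alpha> m "Suc J" "\<lambda>_. 1"] False unfolding F_def \<alpha>'_def m_def by simp
    finally show ?thesis .
  qed
  moreover have "0 < \<gamma>" unfolding \<gamma>_def by simp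
  moreover have "\<gamma> \<le> 1"
    using power_le_one[of "1/3 :: real" "Suc J"] unfolding \<gamma>_def by simp
  ultimately show ?thesis by blast
qed

section \<open>Loss of memory\<close>

text \<open>Cutting at height \<open>f e\<close> removes mass only below \<open>e\<close>, where
  \<open>f \<le> K * F\<close>. All masses \<open>s \<le> M1\<close> are offered because two
  functions have to be brought to the same mass; scaling down keeps monotonicity, domination and
  flatness near 0.\<close>

lemma truncate_scale:
  assumes b: "0 < \<beta>" "\<beta> < 1" and F: "cone_density \<beta> F" and e: "0 < e" "e < 1"
    and f: "decr f" "integrable unit_leb f" and K: "0 \<le> K" "\<And>x. 0 < x \<Longrightarrow> x < 1 \<Longrightarrow> f x \<le> K * F x"
  shows "\<exists>M1. 0 \<le> M1 \<and> M1 \<le> (\<integral>x. f x \<partial>unit_leb)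
    \<and> (\<integral>x. f x \<partial>unit_leb) - K * (12 / (1 - \<beta>)\<^sup>2 * e powr (1 - \<beta>)) \<le> M1
    \<and> (\<forall>s. 0 \<le> s \<longrightarrow> s \<le> M1 \<longrightarrow> (\<exists>f'. decr f' \<and> integrable unit_leb f' \<and> (\<integral>x. f' x \<partial>unit_leb) = s
      \<and> (\<forall>x. 0 < x \<longrightarrow> x < 1 \<longrightarrow> f' x \<le> f x) \<and> (\<forall>x. 0 < x \<longrightarrow> x < e \<longrightarrow> f' x = f' e)))"
proof -
  define f1 where "f1 = (\<lambda>x. if x < e then f e else f x)"
  define M1 where "M1 = (\<integral>x. f1 x \<partial>unit_leb)"
  have d: "decr f1" using e decrD[OF f(1)] decr_nonneg[OF f(1)] unfolding f1_def
    by (intro decrI) auto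
  have le: "f1 x \<le> f x" if "0 < x" "x < 1" for x using that e decrD[OF f(1), of x e] by (auto simp: f1_def)
  have i: "integrable unit_leb f1" by (rule decr_integrable_bound[OF d f(2) le])
  have F': "decr F" "integrable unit_leb F" using F by (auto simp: cone_density_def)
  have nn: "0 \<le> M1" unfolding M1_def by (intro unit_integral_nonneg decr_nonneg[OF d])
  have fe: "0 \<le> f e" using decr_nonneg f e by auto
  have "(\<integral>x. f x \<partial>unit_leb) - M1 = (\<integral>x. f x - f1 x \<partial>unit_leb)"
    unfolding M1_def using i f by simp
  also have "\<dots> \<le> (\<integral>x. K * (if x < e then F x else 0) \<partial>unit_leb)"
  proof (rule unit_integral_mono)
    show "f x - f1 x \<le> K * (if x < e then F x else 0)" if "0 < x" "x < 1" for x
      using K(2)[OF that] fe by (auto simp: f1_def)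
  qed (use i f F' in \<open>auto intro!: unit_integrable_if\<close>)
  also have "\<dots> \<le> K * (12 / (1 - \<beta>)\<^sup>2 * e powr (1 - \<beta>))"
    using mult_left_mono[OF cone_density_mass_near_0[OF b F, of e] K(1)] e by simp
  finally have "(\<integral>x. f x \<partial>unit_leb) - K * (12 / (1 - \<beta>)\<^sup>2 * e powr (1 - \<beta>)) \<le> M1" by simp
  moreover have "M1 \<le> (\<integral>x. f x \<partial>unit_leb)" unfolding M1_def by (rule unit_integral_mono[OF i f(2) le])
  moreover have "\<exists>f'. decr f' \<and> integrable unit_leb f' \<and> (\<integral>x. f' x \<partial>unit_leb) = s
      \<and> (\<forall>x. 0 < x \<longrightarrow> x < 1 \<longrightarrow> f' x \<le> f x) \<and> (\<forall>x. 0 < x \<longrightarrow> x < e \<longrightarrow> f' x = f' e)"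
    if s: "0 \<le> s" "s \<le> M1" for s
  proof (intro exI[of _ "\<lambda>x. s / M1 * f1 x"] conjI allI impI)
    \<comment> \<open>If \<open>M1 = 0\<close>, then also \<open>s = 0\<close>, and the quotient is
      0 by the convention for division.\<close>
    have r: "0 \<le> s / M1" "s / M1 \<le> 1" using s by (auto simp: divide_simps)
    show "decr (\<lambda>x. s / M1 * f1 x)" using decr_mult[OF decr_const[OF r(1)] d] .
    show "integrable unit_leb (\<lambda>x. s / M1 * f1 x)" using i by simp
    show "(\<integral>x. s / M1 * f1 x \<partial>unit_leb) = s" using s by (auto simp: M1_def[symmetric])
    show "s / M1 * f1 x \<le> f x" if "0 < x" "x < 1" for x
      using le[OF that] mult_mono[OF r(2) order.refl, of "f1 x"] decr_nonneg[OF d that] by simp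
    show "s / M1 * f1 x = s / M1 * f1 e" if "x < e" for x
      using that by (simp add: f1_def)
  qed
  ultimately show ?thesis using nn by blast
qed

text \<open>The induction advances \<alpha> and \<open>F\<close> by one block and keeps
  \<open>K\<close>: a remainder lies below the transported truncation, which lies below
  \<open>K\<close> times the transported \<open>F\<close>. The first summand of the bound collects
  what is cut off from both functions in all rounds, the second is the mass still uncoupled.\<close>

lemma coupling:
  assumes b: "0 < \<beta>" "\<beta> < 1" and \<gamma>: "0 < \<gamma>" "\<gamma> \<le> 1"
    "\<And>\<alpha> n x. pm_sequence \<beta> \<alpha> \<Longrightarrow> 0 < x \<Longrightarrow> x < 1 \<Longrightarrow> \<gamma> \<le> transfer_iter \<alpha> n (\<lambda>_. 1) x"
    and e: "0 < e" "e < 1" "(1 + \<beta> / 4 * real m) powr (- 1 / \<beta>) \<le> e / 2"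
    and K: "0 \<le> K"
    and pm: "pm_sequence \<beta> \<alpha>" and F: "cone_density \<beta> F" and f: "decr f" and g: "decr g"
    and le: "\<And>x. 0 < x \<Longrightarrow> x < 1 \<Longrightarrow> f x \<le> K * F x" "\<And>x. 0 < x \<Longrightarrow> x < 1 \<Longrightarrow> g x \<le> K * F x"
    and eq: "(\<integral>x. f x \<partial>unit_leb) = M" "(\<integral>x. g x \<partial>unit_leb) = M"
  shows "(\<integral>x. \<bar>transfer_iter \<alpha> (k * Suc m) (\<lambda>x. f x - g x) x\<bar> \<partial>unit_leb)
    \<le> 2 * real k * K * (12 / (1 - \<beta>)\<^sup>2 * e powr (1 - \<beta>)) + 2 * (1 - \<gamma> / 6) ^ k * M"
  using pm F f g le eq
proof (induction k arbitrary: \<alpha> F f g M)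
  case 0
  have KF: "integrable unit_leb (\<lambda>x. K * F x)" using 0(2) by (simp add: cone_density_def)
  have i: "integrable unit_leb f" "integrable unit_leb g"
    using decr_integrable_bound[OF 0(3) KF 0(5)] decr_integrable_bound[OF 0(4) KF 0(6)] by auto
  have "(\<integral>x. \<bar>f x - g x\<bar> \<partial>unit_leb) \<le> (\<integral>x. f x + g x \<partial>unit_leb)"
  proof (intro unit_integral_mono)
    fix x :: real assume "0 < x" "x < 1"
    then show "\<bar>f x - g x\<bar> \<le> f x + g x"
      using decr_nonneg[OF 0(3), of x] decr_nonneg[OF 0(4), of x] by linarith
  qed (use i in auto)
  then show ?case using i 0(7,8) by simp
next
  case (Suc k)
  interpret pm_sequence \<beta> \<alpha> by (rule Suc.prems)
  let ?D = "12 / (1 - \<beta>)\<^sup>2 * e powr (1 - \<beta>)" and ?N = "Suc m" and ?\<alpha> = "shift (Suc m) \<alpha>"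
  note F = Suc.prems(2) and f = Suc.prems(3) and g = Suc.prems(4) and le = Suc.prems(5,6) and eq = Suc.prems(7,8)
  have KF: "integrable unit_leb (\<lambda>x. K * F x)" using F by (simp add: cone_density_def)
  have i: "integrable unit_leb f" "integrable unit_leb g"
    using decr_integrable_bound[OF f KF le(1)] decr_integrable_bound[OF g KF le(2)] by auto
  obtain Mf where Mf: "0 \<le> Mf" "Mf \<le> M" "M - K * ?D \<le> Mf"
    "\<And>s. 0 \<le> s \<Longrightarrow> s \<le> Mf \<Longrightarrow> \<exists>f'. decr f' \<and> integrable unit_leb f' \<and> (\<integral>x. f' x \<partial>unit_leb) = s
      \<and> (\<forall>x. 0 < x \<longrightarrow> x < 1 \<longrightarrow> f' x \<le> f x) \<and> (\<forall>x. 0 < x \<longrightarrow> x < e \<longrightarrow> f' x = f' e)"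
    using truncate_scale[OF b F e(1,2) f i(1) K le(1)] unfolding eq by blast
  obtain Mg where Mg: "0 \<le> Mg" "Mg \<le> M" "M - K * ?D \<le> Mg"
    "\<And>s. 0 \<le> s \<Longrightarrow> s \<le> Mg \<Longrightarrow> \<exists>f'. decr f' \<and> integrable unit_leb f' \<and> (\<integral>x. f' x \<partial>unit_leb) = s
      \<and> (\<forall>x. 0 < x \<longrightarrow> x < 1 \<longrightarrow> f' x \<le> g x) \<and> (\<forall>x. 0 < x \<longrightarrow> x < e \<longrightarrow> f' x = f' e)"
    using truncate_scale[OF b F e(1,2) g i(2) K le(2)] unfolding eq by blast
  \<comment> \<open>The smaller of the two truncated masses is available for both functions.\<close>
  define s where "s = min Mf Mg"
  have s: "0 \<le> s" "s \<le> Mf" "s \<le> Mg" "s \<le> M" "M - s \<le> K * ?D" using Mf Mg by (auto simp: s_def)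
  obtain f2 where f2: "decr f2" "integrable unit_leb f2" "(\<integral>x. f2 x \<partial>unit_leb) = s"
    "\<And>x. 0 < x \<Longrightarrow> x < 1 \<Longrightarrow> f2 x \<le> f x" "\<And>x. 0 < x \<Longrightarrow> x < e \<Longrightarrow> f2 x = f2 e"
    using Mf(4)[OF s(1,2)] by blast
  obtain g2 where g2: "decr g2" "integrable unit_leb g2" "(\<integral>x. g2 x \<partial>unit_leb) = s"
    "\<And>x. 0 < x \<Longrightarrow> x < 1 \<Longrightarrow> g2 x \<le> g x" "\<And>x. 0 < x \<Longrightarrow> x < e \<Longrightarrow> g2 x = g2 e"
    using Mg(4)[OF s(1,3)] by blast
  \<comment> \<open>The height to be coupled: by \<open>iter_ge_mean\<close>, both transported
    truncations lie above this constant.\<close>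
  define c where "c = \<gamma> / 6 * s"
  have c: "0 \<le> c" using \<gamma> s by (simp add: c_def)
  have l: "linv_iter \<alpha> m 1 \<le> e / 2" using linv_iter_1_le[of m] e by linarith
  have step: "decr (\<lambda>x. transfer_iter \<alpha> ?N p2 x - c)
      \<and> (\<forall>x. 0 < x \<longrightarrow> x < 1 \<longrightarrow> transfer_iter \<alpha> ?N p2 x - c \<le> K * transfer_iter \<alpha> ?N F x)
      \<and> (\<integral>x. transfer_iter \<alpha> ?N p2 x - c \<partial>unit_leb) = (1 - \<gamma> / 6) * s"
    if p2: "decr p2" "integrable unit_leb p2" "(\<integral>x. p2 x \<partial>unit_leb) = s"
      "\<And>x. 0 < x \<Longrightarrow> x < 1 \<Longrightarrow> p2 x \<le> p x" "\<And>x. 0 < x \<Longrightarrow> x < e \<Longrightarrow> p2 x = p2 e"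
      and p: "\<And>x. 0 < x \<Longrightarrow> x < 1 \<Longrightarrow> p x \<le> K * F x" for p p2
  proof (intro conjI allI impI)
    have low: "c \<le> transfer_iter \<alpha> ?N p2 x" if "0 < x" "x < 1" for x
      using iter_ge_mean[OF p2(1,2) _ _ e(1,2) p2(5) l that, of \<gamma>] \<gamma> shift_pm by (simp add: c_def p2(3))
    show "decr (\<lambda>x. transfer_iter \<alpha> ?N p2 x - c)"
      using low decrD[OF iter_decr[OF p2(1)], of _ _ ?N] by (intro decrI) auto
    show "transfer_iter \<alpha> ?N p2 x - c \<le> K * transfer_iter \<alpha> ?N F x" if x: "0 < x" "x < 1" for x
    proof -
      have "transfer_iter \<alpha> ?N p2 x \<le> transfer_iter \<alpha> ?N (\<lambda>x. K * F x) x"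
        by (intro iter_mono x) (meson p2(4) p order.trans)
      then show ?thesis using c unfolding transfer_iter_linear by linarith
    qed
    show "(\<integral>x. transfer_iter \<alpha> ?N p2 x - c \<partial>unit_leb) = (1 - \<gamma> / 6) * s"
      using iter_integral[OF p2(2), of ?N] p2(3) by (simp add: c_def algebra_simps del: transfer_iter.simps)
  qed
  let ?R = "\<lambda>x. transfer_iter ?\<alpha> (k * ?N) (\<lambda>x. (transfer_iter \<alpha> ?N f2 x - c) - (transfer_iter \<alpha> ?N g2 x - c)) x"
  have IH: "(\<integral>x. \<bar>?R x\<bar> \<partial>unit_leb) \<le> 2 * real k * K * ?D + 2 * (1 - \<gamma> / 6) ^ k * ((1 - \<gamma> / 6) * s)"
    by (rule Suc.IH[OF shift_pm iter_cone_density[OF F, of ?N]]) (use step[OF f2 le(1)] step[OF g2 le(2)] in auto)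
  let ?E = "\<lambda>p x. transfer_iter \<alpha> (Suc k * ?N) p x"
  have trash: "(\<integral>x. \<bar>?E (\<lambda>x. p x - p2 x) x\<bar> \<partial>unit_leb) \<le> K * ?D"
    if "integrable unit_leb p" "integrable unit_leb p2" "(\<integral>x. p x \<partial>unit_leb) = M" "(\<integral>x. p2 x \<partial>unit_leb) = s"
      "\<And>x. 0 < x \<Longrightarrow> x < 1 \<Longrightarrow> p2 x \<le> p x" for p p2
  proof -
    have "(\<integral>x. \<bar>?E (\<lambda>x. p x - p2 x) x\<bar> \<partial>unit_leb) \<le> (\<integral>x. \<bar>p x - p2 x\<bar> \<partial>unit_leb)"
      using that by (intro iter_L1_le) auto
    also have "\<dots> = (\<integral>x. p x - p2 x \<partial>unit_leb)" using that(5) by (intro unit_integral_cong) simp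
    also have "\<dots> = M - s" using that by simp
    finally show ?thesis using s by simp
  qed
  \<comment> \<open>The constant \<open>c\<close> cancels in the difference, which leaves the two
    truncation errors and the remainder for the induction.\<close>
  have split: "?E (\<lambda>x. f x - g x) x = ?E (\<lambda>x. f x - f2 x) x - ?E (\<lambda>x. g x - g2 x) x + ?R x" for x
  proof -
    have "?R x = transfer_iter ?\<alpha> (k * ?N) (transfer_iter \<alpha> ?N (\<lambda>x. f2 x - g2 x)) x"
      unfolding transfer_iter_linear(2) by simp
    also have "\<dots> = ?E (\<lambda>x. f2 x - g2 x) x"
      by (simp only: mult_Suc transfer_iter_add)
    finally show ?thesis unfolding transfer_iter_linear(2) by simp
  qed
  have ii: "integrable unit_leb (?E p)" if "integrable unit_leb p" for p using iter_integral(1)[OF that] .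
  have iR: "integrable unit_leb ?R"
    using pm_sequence.iter_integral(1)[OF shift_pm] iter_integral(1)[OF f2(2)] iter_integral(1)[OF g2(2)]
    by (auto simp del: transfer_iter.simps)
  have "(\<integral>x. \<bar>?E (\<lambda>x. f x - g x) x\<bar> \<partial>unit_leb) \<le>
      (\<integral>x. \<bar>?E (\<lambda>x. f x - f2 x) x\<bar> + \<bar>?E (\<lambda>x. g x - g2 x) x\<bar> + \<bar>?R x\<bar> \<partial>unit_leb)"
    unfolding split using ii[of "\<lambda>x. f x - f2 x"] ii[of "\<lambda>x. g x - g2 x"] iR i f2(2) g2(2)
    by (intro unit_integral_mono) (auto simp del: transfer_iter.simps)
  also have "\<dots> = (\<integral>x. \<bar>?E (\<lambda>x. f x - f2 x) x\<bar> \<partial>unit_leb) + (\<integral>x. \<bar>?E (\<lambda>x. g x - g2 x) x\<bar> \<partial>unit_leb)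
      + (\<integral>x. \<bar>?R x\<bar> \<partial>unit_leb)"
    using ii[of "\<lambda>x. f x - f2 x"] ii[of "\<lambda>x. g x - g2 x"] iR i f2(2) g2(2)
    by (subst Bochner_Integration.integral_add | simp del: transfer_iter.simps)+
  also have "\<dots> \<le> K * ?D + K * ?D + (2 * real k * K * ?D + 2 * (1 - \<gamma> / 6) ^ k * ((1 - \<gamma> / 6) * s))"
    using IH trash[OF i(1) f2(2) eq(1) f2(3,4)] trash[OF i(2) g2(2) eq(2) g2(3,4)] by (intro add_mono)
  also have "2 * (1 - \<gamma> / 6) ^ k * ((1 - \<gamma> / 6) * s) \<le> 2 * (1 - \<gamma> / 6) ^ k * ((1 - \<gamma> / 6) * M)"
    using s \<gamma> by (intro mult_left_mono) auto
  finally show ?case by (simp add: algebra_simps add_divide_distrib)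
qed

lemma L1_trivial_bound:
  assumes pm: "pm_sequence \<beta> \<alpha>" and F: "cone_density \<beta> F" and f: "decr f" and g: "decr g"
    and le: "\<And>x. 0 < x \<Longrightarrow> x < 1 \<Longrightarrow> f x \<le> K * F x" "\<And>x. 0 < x \<Longrightarrow> x < 1 \<Longrightarrow> g x \<le> K * F x"
  shows "(\<integral>x. \<bar>transfer_iter \<alpha> N (\<lambda>x. f x - g x) x\<bar> \<partial>unit_leb) \<le> 2 * K"
    and "(\<integral>x. f x \<partial>unit_leb) \<le> K"
    and "integrable unit_leb f" "integrable unit_leb g"
proof -
  have KF: "integrable unit_leb (\<lambda>x. K * F x)" "(\<integral>x. K * F x \<partial>unit_leb) = K"
    using F by (auto simp: cone_density_def)
  show i: "integrable unit_leb f" "integrable unit_leb g"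
    using decr_integrable_bound[OF f KF(1) le(1)] decr_integrable_bound[OF g KF(1) le(2)] by auto
  have fK: "(\<integral>x. f x \<partial>unit_leb) \<le> K" "(\<integral>x. g x \<partial>unit_leb) \<le> K"
    using unit_integral_mono[OF i(1) KF(1) le(1)] unit_integral_mono[OF i(2) KF(1) le(2)] KF(2) by auto
  then show "(\<integral>x. f x \<partial>unit_leb) \<le> K" by simp
  have "(\<integral>x. \<bar>transfer_iter \<alpha> N (\<lambda>x. f x - g x) x\<bar> \<partial>unit_leb) \<le> (\<integral>x. \<bar>f x - g x\<bar> \<partial>unit_leb)"
    using pm i by (intro pm_sequence.iter_L1_le) auto
  also have "\<dots> \<le> (\<integral>x. f x + g x \<partial>unit_leb)"
  proof (intro unit_integral_mono)
    fix x :: real assume "0 < x" "x < 1"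
    then show "\<bar>f x - g x\<bar> \<le> f x + g x"
      using decr_nonneg[OF f, of x] decr_nonneg[OF g, of x] by linarith
  qed (use i in auto)
  also have "\<dots> \<le> 2 * K" using i fK by simp
  finally show "(\<integral>x. \<bar>transfer_iter \<alpha> N (\<lambda>x. f x - g x) x\<bar> \<partial>unit_leb) \<le> 2 * K" .
qed

lemma memory_loss_blocks:
  assumes b: "0 < \<beta>" "\<beta> < 1"
  shows "\<exists>D \<theta>. 1 \<le> D \<and> 0 < \<theta> \<and> \<theta> < 1 \<and>
    (\<forall>\<alpha> F f g K k n. pm_sequence \<beta> \<alpha> \<longrightarrow> cone_density \<beta> F \<longrightarrow> decr f \<longrightarrow> decr g \<longrightarrow> 0 \<le> K \<longrightarrow>
      (\<forall>x. 0 < x \<longrightarrow> x < 1 \<longrightarrow> f x \<le> K * F x) \<longrightarrow> (\<forall>x. 0 < x \<longrightarrow> x < 1 \<longrightarrow> g x \<le> K * F x) \<longrightarrow>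
      (\<integral>x. f x \<partial>unit_leb) = (\<integral>x. g x \<partial>unit_leb) \<longrightarrow> 0 < n \<longrightarrow>
      (\<integral>x. \<bar>transfer_iter \<alpha> (k * n) (\<lambda>x. f x - g x) x\<bar> \<partial>unit_leb)
        \<le> 2 * K * (real k * D * real n powr (1 - 1 / \<beta>) + \<theta> ^ k))"
proof -
  obtain \<gamma> where \<gamma>: "0 < \<gamma>" "\<gamma> \<le> 1"
    "\<And>\<alpha> n x. pm_sequence \<beta> \<alpha> \<Longrightarrow> 0 < x \<Longrightarrow> x < 1 \<Longrightarrow> \<gamma> \<le> transfer_iter \<alpha> n (\<lambda>_. 1) x"
    using iter_one_uniformly_ge[OF b] by blast
  \<comment> \<open>The 24 is the 12 of the mass bound times 2, an upper bound for
    \<open>2 powr (1 - \<beta>)\<close>.\<close>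
  define D where "D = 24 / (1 - \<beta>)\<^sup>2 * (\<beta> / 4) powr (1 - 1 / \<beta>)"
  define \<theta> where "\<theta> = 1 - \<gamma> / 6"
  have sq: "0 < (1 - \<beta>)\<^sup>2" "(1 - \<beta>)\<^sup>2 \<le> 1" using b by (auto simp: power_le_one)
  have s: "1 - 1 / \<beta> < 0" using b by simp
  have D1: "1 \<le> D"
  proof -
    have "1 powr (1 - 1 / \<beta>) \<le> (\<beta> / 4) powr (1 - 1 / \<beta>)" using b s by (intro powr_mono2') auto
    moreover have "1 \<le> 24 / (1 - \<beta>)\<^sup>2" using sq by (simp add: divide_simps)
    ultimately have "1 * 1 \<le> D" unfolding D_def by (intro mult_mono) auto
    then show ?thesis by simp
  qed
  have main: "(\<integral>x. \<bar>transfer_iter \<alpha> (k * n) (\<lambda>x. f x - g x) x\<bar> \<partial>unit_leb)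
        \<le> 2 * K * (real k * D * real n powr (1 - 1 / \<beta>) + \<theta> ^ k)"
    if pm: "pm_sequence \<beta> \<alpha>" and F: "cone_density \<beta> F" and f: "decr f" and g: "decr g" and K: "0 \<le> K"
      and le: "\<And>x. 0 < x \<Longrightarrow> x < 1 \<Longrightarrow> f x \<le> K * F x" "\<And>x. 0 < x \<Longrightarrow> x < 1 \<Longrightarrow> g x \<le> K * F x"
      and eq: "(\<integral>x. f x \<partial>unit_leb) = (\<integral>x. g x \<partial>unit_leb)" and n: "0 < n"
    for \<alpha> F f g K k n
  proof -
    note triv = L1_trivial_bound[OF pm F f g le]
    obtain m where m: "n = Suc m" using n by (cases n) auto
    \<comment> \<open>Twice the bound of \<open>linv_iter_1_le\<close>, so that
      \<open>x\<^sub>m \<le> e / 2\<close>.\<close>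
    define e where "e = 2 * (1 + \<beta> / 4 * real m) powr (- 1 / \<beta>)"
    have "0 < 1 + \<beta> / 4 * real m" using b by (intro add_pos_nonneg) auto
    then have e0: "0 < e" unfolding e_def by simp
    have "12 / (1 - \<beta>)\<^sup>2 * e powr (1 - \<beta>) \<le> 12 / (1 - \<beta>)\<^sup>2 * (2 * ((\<beta> / 4) powr (1 - 1 / \<beta>) * real n powr (1 - 1 / \<beta>)))"
    proof (rule mult_left_mono)
      have "e powr (1 - \<beta>) = 2 powr (1 - \<beta>) * (1 + \<beta> / 4 * real m) powr (1 - 1 / \<beta>)"
      proof -
        have "- 1 / \<beta> * (1 - \<beta>) = 1 - 1 / \<beta>" using b by (simp add: field_simps)
        then show ?thesis using b by (simp add: e_def powr_mult powr_powr)
      qed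
      also have "\<dots> \<le> 2 powr 1 * (\<beta> / 4 * real n) powr (1 - 1 / \<beta>)"
      proof -
        have "0 < \<beta> / 4 * real n" using b n by simp
        moreover have "\<beta> / 4 * real n \<le> 1 + \<beta> / 4 * real m" using b by (simp add: m algebra_simps)
        ultimately show ?thesis using b s by (intro mult_mono powr_mono powr_mono2') auto
      qed
      also have "\<dots> = 2 * ((\<beta> / 4) powr (1 - 1 / \<beta>) * real n powr (1 - 1 / \<beta>))"
        using b by (subst powr_mult) auto
      finally show "e powr (1 - \<beta>) \<le> 2 * ((\<beta> / 4) powr (1 - 1 / \<beta>) * real n powr (1 - 1 / \<beta>))" .
    qed simp
    also have "\<dots> = D * real n powr (1 - 1 / \<beta>)" by (simp add: D_def)
    finally have De: "12 / (1 - \<beta>)\<^sup>2 * e powr (1 - \<beta>) \<le> D * real n powr (1 - 1 / \<beta>)" .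
    show ?thesis
    proof (cases "e < 1")
      case True
      let ?M = "\<integral>x. f x \<partial>unit_leb"
      have "(\<integral>x. \<bar>transfer_iter \<alpha> (k * Suc m) (\<lambda>x. f x - g x) x\<bar> \<partial>unit_leb)
        \<le> 2 * real k * K * (12 / (1 - \<beta>)\<^sup>2 * e powr (1 - \<beta>)) + 2 * (1 - \<gamma> / 6) ^ k * ?M"
        by (rule coupling[OF b \<gamma> e0 True _ K pm F f g le refl eq[symmetric]]) (simp_all add: e_def)
      also have "\<dots> \<le> 2 * real k * K * (D * real n powr (1 - 1 / \<beta>)) + 2 * (1 - \<gamma> / 6) ^ k * K"
        using De K triv(2) \<gamma> by (intro add_mono mult_left_mono) auto
      finally show ?thesis by (simp add: m \<theta>_def algebra_simps)
    next
      case False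
      \<comment> \<open>For a short block the cut-off reaches 1 and no coupling takes place. The
        trivial bound then suffices, as the factor on the right is at least 1: by its first summand
        for \<open>k > 0\<close>, by \<open>\<theta> ^ 0\<close> for \<open>k = 0\<close>.\<close>
      have "1 \<le> real k * D * real n powr (1 - 1 / \<beta>) + \<theta> ^ k"
      proof (cases "k = 0")
        case False
        have "1 powr (1 - \<beta>) \<le> e powr (1 - \<beta>)" using \<open>\<not> e < 1\<close> b by (intro powr_mono2) auto
        moreover have "1 \<le> 12 / (1 - \<beta>)\<^sup>2" using sq by (simp add: divide_simps)
        ultimately have "1 * 1 \<le> 12 / (1 - \<beta>)\<^sup>2 * e powr (1 - \<beta>)" by (intro mult_mono) auto
        also note De
        finally have "1 * 1 \<le> real k * (D * real n powr (1 - 1 / \<beta>))"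
          using False by (intro mult_mono) auto
        moreover have "0 \<le> \<theta> ^ k" using \<gamma> by (simp add: \<theta>_def)
        ultimately show ?thesis by (simp add: mult.assoc)
      qed auto
      then have "2 * K * 1 \<le> 2 * K * (real k * D * real n powr (1 - 1 / \<beta>) + \<theta> ^ k)"
        using K by (intro mult_left_mono) auto
      then show ?thesis using triv(1)[of "k * n"] by linarith
    qed
  qed
  show ?thesis
    using D1 \<gamma>(1,2) by (intro exI[of _ D] exI[of _ \<theta>] conjI allI impI main) (auto simp: \<theta>_def)
qed

lemma rho_nonneg: "0 \<le> rho \<beta> N"
  by (simp add: rho_def)

lemma memory_loss:
  assumes b: "0 < \<beta>" "\<beta> < 1"
  shows "\<exists>C>0. \<forall>\<alpha> F f g K N. pm_sequence \<beta> \<alpha> \<longrightarrow> cone_density \<beta> F \<longrightarrow> decr f \<longrightarrow> decr g \<longrightarrow> 0 \<le> K \<longrightarrow>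
      (\<forall>x. 0 < x \<longrightarrow> x < 1 \<longrightarrow> f x \<le> K * F x) \<longrightarrow> (\<forall>x. 0 < x \<longrightarrow> x < 1 \<longrightarrow> g x \<le> K * F x) \<longrightarrow>
      (\<integral>x. f x \<partial>unit_leb) = (\<integral>x. g x \<partial>unit_leb) \<longrightarrow>
      (\<integral>x. \<bar>transfer_iter \<alpha> N (\<lambda>x. f x - g x) x\<bar> \<partial>unit_leb) \<le> C * K * rho \<beta> N"
proof -
  obtain D \<theta> where D: "1 \<le> D" and \<theta>: "0 < \<theta>" "\<theta> < 1" and
    blocks: "\<And>\<alpha> F f g K k n. pm_sequence \<beta> \<alpha> \<Longrightarrow> cone_density \<beta> F \<Longrightarrow> decr f \<Longrightarrow> decr g \<Longrightarrow> 0 \<le> K \<Longrightarrow>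
      (\<forall>x. 0 < x \<longrightarrow> x < 1 \<longrightarrow> f x \<le> K * F x) \<Longrightarrow> (\<forall>x. 0 < x \<longrightarrow> x < 1 \<longrightarrow> g x \<le> K * F x) \<Longrightarrow>
      (\<integral>x. f x \<partial>unit_leb) = (\<integral>x. g x \<partial>unit_leb) \<Longrightarrow> 0 < n \<Longrightarrow>
      (\<integral>x. \<bar>transfer_iter \<alpha> (k * n) (\<lambda>x. f x - g x) x\<bar> \<partial>unit_leb)
        \<le> 2 * K * (real k * D * real n powr (1 - 1 / \<beta>) + \<theta> ^ k)"
    using memory_loss_blocks[OF b] by blast
  define s where "s = 1 / \<beta> - 1"
  have s: "0 < s" "1 - 1 / \<beta> = - s" "- 1 / \<beta> + 1 = - s" "1 / \<beta> = 1 + s" using b by (auto simp: s_def)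
  \<comment> \<open>With \<open>\<kappa> * ln N\<close> rounds the geometric term
    \<open>\<theta> ^ k\<close> becomes \<open>N powr (- s)\<close>.\<close>
  define \<kappa> where "\<kappa> = s / (- ln \<theta>)"
  \<comment> \<open>The summand \<open>1 / ln 2\<close> absorbs the rounding up of \<open>k\<close>,
    as \<open>1 \<le> ln N / ln 2\<close> for \<open>N \<ge> 2\<close>.\<close>
  define \<kappa>' where "\<kappa>' = \<kappa> + 1 / ln 2"
  have ln\<theta>: "ln \<theta> < 0" using \<theta> by simp
  have \<kappa>: "0 < \<kappa>" "\<kappa> * ln \<theta> = - s" using s ln\<theta> by (auto simp: \<kappa>_def divide_simps)
  have \<kappa>': "0 < \<kappa>'" using \<kappa> by (simp add: \<kappa>'_def add_pos_pos)
  \<comment> \<open>The added 2 covers \<open>N \<le> 1\<close>, where \<open>rho\<close> is 1 and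
    the trivial bound is \<open>2 * K\<close>.\<close>
  define C where "C = 2 * (D * (\<kappa>' * (2 * \<kappa>') powr s) + 1 / ln 2 powr (1 + s)) + 2"
  have C: "2 \<le> C" using D \<kappa>' by (simp add: C_def)
  have "(\<integral>x. \<bar>transfer_iter \<alpha> N (\<lambda>x. f x - g x) x\<bar> \<partial>unit_leb) \<le> C * K * rho \<beta> N"
    if pm: "pm_sequence \<beta> \<alpha>" and F: "cone_density \<beta> F" and f: "decr f" and g: "decr g" and K: "0 \<le> K"
      and le: "\<forall>x. 0 < x \<longrightarrow> x < 1 \<longrightarrow> f x \<le> K * F x" "\<forall>x. 0 < x \<longrightarrow> x < 1 \<longrightarrow> g x \<le> K * F x"
      and eq: "(\<integral>x. f x \<partial>unit_leb) = (\<integral>x. g x \<partial>unit_leb)"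
    for \<alpha> F f g K N
  proof (cases "N \<le> 1")
    case True
    have "2 * K \<le> C * K" using C K by (intro mult_right_mono) auto
    then show ?thesis using L1_trivial_bound(1)[OF pm F f g, of K N] le True by (simp add: rho_def)
  next
    case False
    define L where "L = ln (real N)"
    have L: "ln 2 \<le> L" "0 < L" unfolding L_def using False by auto
    define k where "k = nat \<lceil>\<kappa> * L\<rceil>"
    have kL: "\<kappa> * L \<le> real k" "real k \<le> \<kappa> * L + 1"
      using \<kappa> L by (auto simp: k_def of_nat_nat ceiling_correct)
    have k0: "0 < k" using kL(1) \<kappa> L by (smt (verit) mult_pos_pos of_nat_0 gr0I)
    have k': "real k \<le> \<kappa>' * L"
    proof -
      have "1 \<le> L / ln 2" using L by (simp add: divide_simps)
      moreover have "\<kappa>' * L = \<kappa> * L + L / ln 2" by (simp add: \<kappa>'_def distrib_right)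
      ultimately show ?thesis using kL(2) by linarith
    qed
    have \<theta>k: "\<theta> ^ k \<le> real N powr (- s)"
    proof -
      have "\<theta> ^ k = exp (real k * ln \<theta>)" using \<theta> by (simp add: exp_of_nat_mult)
      also have "\<dots> \<le> exp (\<kappa> * L * ln \<theta>)" using kL(1) ln\<theta> by (simp add: mult_right_mono_neg)
      also have "\<kappa> * L * ln \<theta> = - s * L" using \<kappa>(2) by (metis mult.assoc mult.commute)
      also have "exp (- s * L) = real N powr (- s)" using False by (simp add: powr_def L_def)
      finally show ?thesis .
    qed
    let ?I = "\<integral>x. \<bar>transfer_iter \<alpha> N (\<lambda>x. f x - g x) x\<bar> \<partial>unit_leb"
    have I1: "?I \<le> 2 * K * (real k * D * (real N / (2 * real k)) powr (- s) + \<theta> ^ k)"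
    proof (cases "N < k")
      case True
      \<comment> \<open>With more rounds than steps there is no positive block length. The base of
        the power is then below 1, so the claimed bound exceeds the trivial one.\<close>
      have "1 powr (- s) \<le> (real N / (2 * real k)) powr (- s)"
        using True False s k0 by (intro powr_mono2') (auto simp: divide_simps)
      moreover have "1 * 1 \<le> real k * D" using k0 D by (intro mult_mono) auto
      ultimately have "1 * 1 \<le> real k * D * (real N / (2 * real k)) powr (- s)"
        by (intro mult_mono) auto
      moreover have "0 \<le> \<theta> ^ k" using \<theta> by simp
      ultimately have "2 * K * 1 \<le> 2 * K * (real k * D * (real N / (2 * real k)) powr (- s) + \<theta> ^ k)"
        using K by (intro mult_left_mono) auto
      then show ?thesis using L1_trivial_bound(1)[OF pm F f g, of K N] le by simp
    next
      case nk: False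
      define n where "n = N div k"
      have n0: "0 < n" using nk k0 by (simp add: n_def div_greater_zero_iff)
      \<comment> \<open>Rounding down to \<open>N div k \<ge> 1\<close> loses at most a factor 2,
        the origin of the 2 in \<open>N / (2 * k)\<close>.\<close>
      have "N < k * (n + 1)" using k0 unfolding n_def by (metis Suc_eq_plus1 dividend_less_times_div mult_Suc_right add.commute)
      also have "\<dots> \<le> k * (2 * n)" using n0 by (intro mult_le_mono2) auto
      finally have "real N \<le> real (k * (2 * n))" by (simp only: of_nat_le_iff less_imp_le)
      then have nN: "real N / (2 * real k) \<le> real n" using k0 by (simp add: divide_simps mult_ac)
      have kn: "k * n \<le> N" by (simp add: n_def)
      interpret sh: pm_sequence \<beta> "shift (k * n) \<alpha>" by (rule pm_sequence.shift_pm[OF pm])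
      \<comment> \<open>The leftover \<open>N - k * n\<close> steps do not increase the L1
        norm.\<close>
      have "?I = (\<integral>x. \<bar>transfer_iter (shift (k * n) \<alpha>) (N - k * n) (transfer_iter \<alpha> (k * n) (\<lambda>x. f x - g x)) x\<bar> \<partial>unit_leb)"
        using transfer_iter_add[of \<alpha> "k * n" "N - k * n"] kn by simp
      also have "\<dots> \<le> (\<integral>x. \<bar>transfer_iter \<alpha> (k * n) (\<lambda>x. f x - g x) x\<bar> \<partial>unit_leb)"
        using L1_trivial_bound(3,4)[OF pm F f g, of K] le
        by (intro sh.iter_L1_le pm_sequence.iter_integral[OF pm]) auto
      also have "\<dots> \<le> 2 * K * (real k * D * real n powr (- s) + \<theta> ^ k)"
        using blocks[OF pm F f g K le eq n0, of k] s by simp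
      also have "\<dots> \<le> 2 * K * (real k * D * (real N / (2 * real k)) powr (- s) + \<theta> ^ k)"
        using nN K D s k0 False by (intro mult_left_mono add_right_mono powr_mono2') auto
      finally show ?thesis .
    qed
    have N0: "0 < real N" using False by simp
    have rho: "rho \<beta> N = real N powr (- s) * L powr (1 + s)"
      using False s by (simp add: rho_def L_def)
    have "real k * (real N / (2 * real k)) powr (- s) = real k * (2 * real k / real N) powr s"
      using N0 k0 by (simp add: powr_minus powr_divide divide_simps)
    also have "\<dots> \<le> (\<kappa>' * L) * (2 * (\<kappa>' * L) / real N) powr s"
      using k' s N0 k0 L \<kappa>' by (intro mult_mono powr_mono2 divide_right_mono) auto
    also have "\<dots> = \<kappa>' * (2 * \<kappa>') powr s * rho \<beta> N"
      using L \<kappa>' N0 by (simp add: rho powr_add powr_mult powr_divide powr_minus field_simps)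
    finally have t1: "real k * (real N / (2 * real k)) powr (- s) \<le> \<kappa>' * (2 * \<kappa>') powr s * rho \<beta> N" .
    have t2: "real N powr (- s) \<le> 1 / ln 2 powr (1 + s) * rho \<beta> N"
    proof -
      have "ln 2 powr (1 + s) \<le> L powr (1 + s)" using L s by (intro powr_mono2) auto
      then have "real N powr (- s) * ln 2 powr (1 + s) \<le> rho \<beta> N"
        unfolding rho by (intro mult_left_mono) auto
      then show ?thesis by (simp add: divide_simps mult.commute)
    qed
    have "?I \<le> 2 * K * (D * (real k * (real N / (2 * real k)) powr (- s)) + real N powr (- s))"
    proof -
      have "2 * K * (real k * D * (real N / (2 * real k)) powr (- s) + \<theta> ^ k)
        \<le> 2 * K * (real k * D * (real N / (2 * real k)) powr (- s) + real N powr (- s))"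
        using \<theta>k K by (intro mult_left_mono add_left_mono) auto
      then show ?thesis using I1 by (simp add: mult_ac)
    qed
    also have "\<dots> \<le> 2 * K * (D * (\<kappa>' * (2 * \<kappa>') powr s * rho \<beta> N) + 1 / ln 2 powr (1 + s) * rho \<beta> N)"
      using t1 t2 K D by (intro mult_left_mono add_mono) auto
    also have "\<dots> = (C - 2) * K * rho \<beta> N" unfolding C_def by (simp add: algebra_simps)
    also have "\<dots> \<le> C * K * rho \<beta> N" using K rho_nonneg by (intro mult_right_mono) auto
    finally show ?thesis .
  qed
  then show ?thesis using C by (intro exI[of _ C]) auto
qed

section \<open>Products of Lipschitz observables\<close>

text \<open>A sum of terms \<open>H\<^sub>i * F\<^sub>i\<close> over inverse branches, with \<open>F = \<Sum>F\<^sub>i\<close>, all \<open>F\<^sub>i\<close> decreasing,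
  \<open>\<bar>H\<^sub>i\<bar> \<le> a\<close> and \<open>H\<^sub>i\<close> Lipschitz with constant \<open>b\<close>, satisfies these two inequalities. Multiplying
  by \<open>f\<close> enlarges \<open>a + b\<close> at most by the factor \<open>norm_Lip f\<close>, so no constant per factor accumulates.\<close>

definition lip_dominated :: "real \<Rightarrow> real \<Rightarrow> (real \<Rightarrow> real) \<Rightarrow> (real \<Rightarrow> real) \<Rightarrow> bool" where
  "lip_dominated a b F \<Phi> \<longleftrightarrow> (\<forall>x. 0 < x \<longrightarrow> x < 1 \<longrightarrow> \<bar>\<Phi> x\<bar> \<le> a * F x) \<and>
    (\<forall>x y. 0 < x \<longrightarrow> x \<le> y \<longrightarrow> y < 1 \<longrightarrow> \<bar>\<Phi> y - \<Phi> x\<bar> \<le> b * (y - x) * F y + a * (F x - F y))"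

lemma lip_dominatedD:
  assumes "lip_dominated a b F \<Phi>"
  shows "0 < x \<Longrightarrow> x < 1 \<Longrightarrow> \<bar>\<Phi> x\<bar> \<le> a * F x"
    "0 < x \<Longrightarrow> x \<le> y \<Longrightarrow> y < 1 \<Longrightarrow> \<bar>\<Phi> y - \<Phi> x\<bar> \<le> b * (y - x) * F y + a * (F x - F y)"
  using assms by (auto simp: lip_dominated_def)

lemma lip_dominated_self: "decr F \<Longrightarrow> lip_dominated 1 0 F F"
  using decrD[of F] decr_nonneg[of F] by (auto simp: lip_dominated_def)

lemma lip_dominated_cong:
  "(\<And>x. 0 < x \<Longrightarrow> x < 1 \<Longrightarrow> \<Phi> x = \<Psi> x) \<Longrightarrow> (\<And>x. 0 < x \<Longrightarrow> x < 1 \<Longrightarrow> F x = G x) \<Longrightarrow>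
   lip_dominated a b F \<Phi> \<Longrightarrow> lip_dominated a b G \<Psi>"
  by (simp add: lip_dominated_def)

lemma lip_dominated_mult:
  assumes P: "lip_dominated a b F \<Phi>"
    and f: "\<And>x. 0 < x \<Longrightarrow> x < 1 \<Longrightarrow> \<bar>f x\<bar> \<le> c"
      "\<And>x y. 0 < x \<Longrightarrow> x \<le> y \<Longrightarrow> y < 1 \<Longrightarrow> \<bar>f y - f x\<bar> \<le> d * (y - x)"
  shows "lip_dominated (a * c) (b * c + a * d) F (\<lambda>x. \<Phi> x * f x)"
  unfolding lip_dominated_def
proof (intro conjI allI impI)
  fix x :: real assume x: "0 < x" "x < 1"
  have "\<bar>\<Phi> x * f x\<bar> \<le> (a * F x) * c"
    unfolding abs_mult using lip_dominatedD(1)[OF P x] f(1)[OF x] by (intro mult_mono) auto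
  then show "\<bar>\<Phi> x * f x\<bar> \<le> a * c * F x" by (simp add: mult_ac)
next
  fix x y :: real assume xy: "0 < x" "x \<le> y" "y < 1"
  have y: "0 < y" "x < 1" using xy by auto
  \<comment> \<open>Pairing the increment of \<open>f\<close> with \<open>\<Phi> y\<close>, and not
    with \<open>\<Phi> x\<close>, produces the factor \<open>F y\<close> that the definition asks
    for.\<close>
  have "\<bar>\<Phi> y * f y - \<Phi> x * f x\<bar> = \<bar>\<Phi> y * (f y - f x) + (\<Phi> y - \<Phi> x) * f x\<bar>"
    by (simp add: algebra_simps)
  also have "\<dots> \<le> \<bar>\<Phi> y\<bar> * \<bar>f y - f x\<bar> + \<bar>\<Phi> y - \<Phi> x\<bar> * \<bar>f x\<bar>"
    by (metis abs_mult abs_triangle_ineq)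
  also have "\<dots> \<le> (a * F y) * (d * (y - x)) + (b * (y - x) * F y + a * (F x - F y)) * c"
    using lip_dominatedD(1)[OF P y(1) xy(3)] lip_dominatedD(2)[OF P xy] f(1)[OF xy(1) y(2)] f(2)[OF xy]
    by (intro add_mono mult_mono) auto
  finally show "\<bar>\<Phi> y * f y - \<Phi> x * f x\<bar> \<le> (b * c + a * d) * (y - x) * F y + a * c * (F x - F y)"
    by (simp add: algebra_simps)
qed

text \<open>The variation of the weight costs nothing:
  \<open>p * (F x1 - F y1) * w + p * F x1 * (v - w)\<close> is exactly
  \<open>p * (F x1 * v - F y1 * w)\<close>, the decrease of the left-branch term of
  \<open>transfer a F\<close>. The Lipschitz part keeps its constant because inverse branches do not
  expand distances.\<close>

lemma lip_dominated_transfer: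
  assumes a: "0 \<le> a" "a \<le> 1" and F: "decr F" and pq: "0 \<le> p" "0 \<le> q" and P: "lip_dominated p q F \<Phi>"
  shows "lip_dominated p q (transfer a F) (transfer a \<Phi>)"
  unfolding lip_dominated_def
proof (intro conjI allI impI)
  fix x :: real assume x: "0 < x" "x < 1"
  have "\<bar>transfer a \<Phi> x\<bar> \<le> transfer a (\<lambda>x. \<bar>\<Phi> x\<bar>) x" using transfer_abs[OF a x] .
  also have "\<dots> \<le> transfer a (\<lambda>x. p * F x) x"
    using lip_dominatedD(1)[OF P] x by (intro transfer_mono a) auto
  finally show "\<bar>transfer a \<Phi> x\<bar> \<le> p * transfer a F x" by (simp add: transfer_linear)
next
  fix x y :: real assume xy: "0 < x" "x \<le> y" "y < 1"
  define x1 y1 v w x2 y2 where "x1 = linv a x" and "y1 = linv a y" and "v = lweight a x" and "w = lweight a y"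
    and "x2 = (x + 1) / 2" and "y2 = (y + 1) / 2"
  have r: "0 < x1" "x1 \<le> y1" "y1 < 1" "x1 < 1" "0 < x2" "x2 \<le> y2" "y2 < 1" "0 < y1"
    using linv_unit[of a x] linv_unit[of a y] linv_mono[of a x y] xy a
    by (auto simp: x1_def y1_def x2_def y2_def)
  have w: "0 \<le> w" "w \<le> v" "v \<le> 1"
    using lweight_bounds[of a x] lweight_bounds[of a y] lweight_antimono[of a x y] a xy by (auto simp: v_def w_def)
  have d1: "y1 - x1 \<le> y - x"
  proof -
    have "y1 - x1 \<le> (y - x) * v" using linv_diff_le[of a x y] a xy by (simp add: x1_def y1_def v_def)
    also have "\<dots> \<le> (y - x) * 1" using w xy by (intro mult_left_mono) auto
    finally show ?thesis by simp
  qed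
  have "\<bar>\<Phi> y1 * w - \<Phi> x1 * v\<bar> = \<bar>(\<Phi> y1 - \<Phi> x1) * w - \<Phi> x1 * (v - w)\<bar>"
    by (simp add: algebra_simps)
  also have "\<dots> \<le> \<bar>\<Phi> y1 - \<Phi> x1\<bar> * w + \<bar>\<Phi> x1\<bar> * (v - w)"
    using abs_triangle_ineq4[of "(\<Phi> y1 - \<Phi> x1) * w" "\<Phi> x1 * (v - w)"] w by (simp add: abs_mult)
  also have "\<dots> \<le> (q * (y1 - x1) * F y1 + p * (F x1 - F y1)) * w + (p * F x1) * (v - w)"
    using lip_dominatedD(2)[OF P r(1-3)] lip_dominatedD(1)[OF P r(1,4)] w
    by (intro add_mono mult_right_mono) auto
  also have "\<dots> \<le> (q * (y - x) * F y1 + p * (F x1 - F y1)) * w + (p * F x1) * (v - w)"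
    using d1 w pq decr_nonneg[OF F r(8,3)] by (intro add_mono mult_right_mono mult_left_mono) auto
  finally have 1: "\<bar>\<Phi> y1 * w - \<Phi> x1 * v\<bar> \<le> q * (y - x) * (F y1 * w) + p * (F x1 * v - F y1 * w)"
    by (simp add: algebra_simps)
  have "\<bar>\<Phi> y2 - \<Phi> x2\<bar> \<le> q * (y2 - x2) * F y2 + p * (F x2 - F y2)"
    by (rule lip_dominatedD(2)[OF P r(5-7)])
  also have "\<dots> \<le> q * (y - x) * F y2 + p * (F x2 - F y2)"
    using xy r pq decr_nonneg[OF F, of y2]
    by (intro add_right_mono mult_right_mono mult_left_mono) (auto simp: x2_def y2_def field_simps)
  finally have 2: "\<bar>\<Phi> y2 - \<Phi> x2\<bar> \<le> q * (y - x) * F y2 + p * (F x2 - F y2)" .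
  have "\<bar>transfer a \<Phi> y - transfer a \<Phi> x\<bar> = \<bar>(\<Phi> y1 * w - \<Phi> x1 * v) + (\<Phi> y2 - \<Phi> x2) / 2\<bar>"
    unfolding transfer_def x1_def y1_def v_def w_def x2_def y2_def by (simp add: algebra_simps diff_divide_distrib)
  also have "\<dots> \<le> \<bar>\<Phi> y1 * w - \<Phi> x1 * v\<bar> + \<bar>\<Phi> y2 - \<Phi> x2\<bar> / 2"
    using abs_triangle_ineq[of "\<Phi> y1 * w - \<Phi> x1 * v" "(\<Phi> y2 - \<Phi> x2) / 2"] by simp
  also have "\<dots> \<le> (q * (y - x) * (F y1 * w) + p * (F x1 * v - F y1 * w)) + (q * (y - x) * F y2 + p * (F x2 - F y2)) / 2"
    using 1 2 by (intro add_mono divide_right_mono) auto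
  also have "\<dots> = q * (y - x) * transfer a F y + p * (transfer a F x - transfer a F y)"
    unfolding transfer_def x1_def y1_def v_def w_def x2_def y2_def
    by (simp add: algebra_simps diff_divide_distrib add_divide_distrib)
  finally show "\<bar>transfer a \<Phi> y - transfer a \<Phi> x\<bar> \<le> q * (y - x) * transfer a F y + p * (transfer a F x - transfer a F y)" .
qed

lemma (in pm_sequence) lip_dominated_iter:
  "decr F \<Longrightarrow> 0 \<le> p \<Longrightarrow> 0 \<le> q \<Longrightarrow> lip_dominated p q F \<Phi> \<Longrightarrow>
   lip_dominated p q (transfer_iter \<alpha> n F) (transfer_iter \<alpha> n \<Phi>)"
  by (induction n) (auto intro!: lip_dominated_transfer alpha iter_decr)

text \<open>Adding \<open>B\<close> makes \<Phi> decreasing, since the decrease of \<open>B\<close>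
  outweighs the permitted increase of \<Phi>. Multiples of \<open>F\<close> are then added
  crosswise, \<open>MB * F\<close> to \<open>A\<close> and \<open>MA * F\<close> to
  \<open>B\<close>: both sums have mass \<open>MA + MB\<close> and both stay decreasing. The
  constant is 2 for \<open>A\<close> plus 1 for \<open>MB\<close>, or 1 for \<open>B\<close> plus 2
  for \<open>MA\<close>.\<close>

lemma lip_dominated_split:
  assumes F: "cone_density \<beta> F" and ab: "0 \<le> a" "0 \<le> b" and P: "lip_dominated a b F \<Phi>"
  shows "\<exists>f g. decr f \<and> decr g \<and> (\<forall>x. 0 < x \<longrightarrow> x < 1 \<longrightarrow> f x \<le> 3 * (a + b) * F x)
    \<and> (\<forall>x. 0 < x \<longrightarrow> x < 1 \<longrightarrow> g x \<le> 3 * (a + b) * F x)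
    \<and> (\<integral>x. f x \<partial>unit_leb) = (\<integral>x. g x \<partial>unit_leb)
    \<and> (\<lambda>x. \<Phi> x - (\<integral>x. \<Phi> x \<partial>unit_leb) * F x) = (\<lambda>x. f x - g x) \<and> integrable unit_leb \<Phi>"
proof -
  have F': "decr F" "integrable unit_leb F" "(\<integral>x. F x \<partial>unit_leb) = 1" using F by (auto simp: cone_density_def)
  define B where "B = (\<lambda>x. (a + b * (1 - x)) * F x)"
  define A where "A = (\<lambda>x. \<Phi> x + B x)"
  have dB: "decr B" unfolding B_def
    using ab by (intro decr_mult decrI F' add_nonneg_nonneg add_left_mono mult_left_mono) auto
  have Bl: "B x \<le> (a + b) * F x" if "0 < x" "x < 1" for x
    unfolding B_def using that ab decr_nonneg[OF F'(1)] mult_left_mono[of "1 - x" 1 b] by (intro mult_right_mono) auto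
  have Al: "A x \<le> 2 * (a + b) * F x" if "0 < x" "x < 1" for x
  proof -
    have "\<Phi> x \<le> a * F x" using lip_dominatedD(1)[OF P that] by linarith
    moreover have "a * F x \<le> (a + b) * F x" using ab decr_nonneg[OF F'(1) that] by (intro mult_right_mono) auto
    ultimately show ?thesis using Bl[OF that] unfolding A_def by (simp add: algebra_simps)
  qed
  have dA: "decr A"
  proof (rule decrI)
    fix x :: real assume x: "0 < x" "x < 1"
    have "0 \<le> b * (1 - x) * F x" using x ab decr_nonneg[OF F'(1) x] by (intro mult_nonneg_nonneg) auto
    then show "0 \<le> A x" using lip_dominatedD(1)[OF P x] unfolding A_def B_def by (simp add: algebra_simps)
  next
    fix x y :: real assume xy: "0 < x" "x \<le> y" "y < 1"
    have "b * (1 - x) * F y \<le> b * (1 - x) * F x"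
      using xy ab decrD[OF F'(1) xy] by (intro mult_left_mono) auto
    moreover have "\<Phi> y - \<Phi> x \<le> b * (y - x) * F y + a * (F x - F y)"
      using lip_dominatedD(2)[OF P xy] by linarith
    ultimately show "A y \<le> A x" unfolding A_def B_def by (simp add: algebra_simps)
  qed
  have iK: "integrable unit_leb (\<lambda>x. c * F x)" "(\<integral>x. c * F x \<partial>unit_leb) = c" for c
    using F' by auto
  have iA: "integrable unit_leb A" by (rule decr_integrable_bound[OF dA iK(1) Al])
  have iB: "integrable unit_leb B" by (rule decr_integrable_bound[OF dB iK(1) Bl])
  have P_eq: "\<Phi> = (\<lambda>x. A x - B x)" by (auto simp: A_def)
  define MA MB where "MA = (\<integral>x. A x \<partial>unit_leb)" and "MB = (\<integral>x. B x \<partial>unit_leb)"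
  have "0 \<le> MA" unfolding MA_def by (rule unit_integral_nonneg) (rule decr_nonneg[OF dA])
  moreover have "MA \<le> 2 * (a + b)"
    using unit_integral_mono[OF iA iK(1) Al] unfolding iK(2) MA_def .
  ultimately have MA: "0 \<le> MA" "MA \<le> 2 * (a + b)" .
  have "0 \<le> MB" unfolding MB_def by (rule unit_integral_nonneg) (rule decr_nonneg[OF dB])
  moreover have "MB \<le> a + b"
    using unit_integral_mono[OF iB iK(1) Bl] unfolding iK(2) MB_def .
  ultimately have MB: "0 \<le> MB" "MB \<le> a + b" .
  have MP: "(\<integral>x. \<Phi> x \<partial>unit_leb) = MA - MB" unfolding P_eq using iA iB by (simp add: MA_def MB_def)
  have scale: "c * F x \<le> d * F x" if "c \<le> d" "0 < x" "x < 1" for c d x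
    using that decr_nonneg[OF F'(1)] by (intro mult_right_mono) auto
  show ?thesis
  proof (rule exI[of _ "\<lambda>x. A x + MB * F x"], rule exI[of _ "\<lambda>x. B x + MA * F x"], intro conjI allI impI)
    show "decr (\<lambda>x. A x + MB * F x)" "decr (\<lambda>x. B x + MA * F x)"
      using MA MB by (auto intro!: decr_add decr_mult decr_const dA dB F')
    show "A x + MB * F x \<le> 3 * (a + b) * F x" if "0 < x" "x < 1" for x
      using Al[OF that] scale[OF MB(2) that] by (simp add: algebra_simps)
    show "B x + MA * F x \<le> 3 * (a + b) * F x" if "0 < x" "x < 1" for x
      using Bl[OF that] scale[OF MA(2) that] by (simp add: algebra_simps)
    show "(\<integral>x. A x + MB * F x \<partial>unit_leb) = (\<integral>x. B x + MA * F x \<partial>unit_leb)"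
      using iA iB F'(2,3) by (simp add: MA_def MB_def)
    show "(\<lambda>x. \<Phi> x - (\<integral>x. \<Phi> x \<partial>unit_leb) * F x) = (\<lambda>x. (A x + MB * F x) - (B x + MA * F x))"
      unfolding MP by (auto simp: A_def algebra_simps)
    show "integrable unit_leb \<Phi>" unfolding P_eq using iA iB by simp
  qed
qed

section \<open>From the closed to the open interval; norms and initial densities\<close>

lemma leb01_unit_indicator:
  fixes f :: "real \<Rightarrow> real"
  shows "indicator {0..1} x *\<^sub>R f x =
    indicator {0<..<1} x *\<^sub>R f x + f 0 * indicator {0} x + f 1 * indicator {1} x"
  by (auto simp: indicator_def)

lemma leb01_measurable_iff:
  fixes f :: "real \<Rightarrow> real"
  shows "f \<in> borel_measurable leb01 \<longleftrightarrow> f \<in> borel_measurable unit_leb"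
proof -
  have s [measurable]: "{0} \<in> sets (lebesgue :: real measure)" "{1} \<in> sets (lebesgue :: real measure)" by auto
  have "(\<lambda>x. indicator {0..1} x *\<^sub>R f x) \<in> borel_measurable lebesgue \<longleftrightarrow>
      (\<lambda>x. indicator {0<..<1} x *\<^sub>R f x) \<in> borel_measurable lebesgue" (is "?a \<in> _ \<longleftrightarrow> ?b \<in> _")
  proof
    assume [measurable]: "?a \<in> borel_measurable lebesgue"
    have "?b = (\<lambda>x. ?a x - f 0 * indicator {0} x - f 1 * indicator {1} x)"
      unfolding leb01_unit_indicator by auto
    also have "\<dots> \<in> borel_measurable lebesgue" by measurable
    finally show "?b \<in> borel_measurable lebesgue" .
  next
    assume [measurable]: "?b \<in> borel_measurable lebesgue"
    show "?a \<in> borel_measurable lebesgue" unfolding leb01_unit_indicator by measurable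
  qed
  then show ?thesis by (simp add: borel_measurable_restrict_space_iff)
qed

lemma AE_unit_endpoints: "AE x in lebesgue. x \<noteq> 0 \<and> x \<noteq> (1::real)"
proof (rule AE_I)
  have "negligible {0, 1 :: real}" by (rule negligible_finite) simp
  then have "{0, 1 :: real} \<in> null_sets lebesgue" by (simp add: negligible_iff_null_sets)
  then show "emeasure lebesgue {0, 1 :: real} = 0" "{0, 1 :: real} \<in> sets lebesgue"
    by (auto simp: null_sets_def)
qed auto

lemma AE_leb01_iff: "(AE x in leb01. P x) \<longleftrightarrow> (AE x in unit_leb. P x)"
proof -
  from AE_unit_endpoints have "AE x in lebesgue. (x \<in> {0..1} \<longrightarrow> P x) \<longleftrightarrow> (x \<in> {0<..<1} \<longrightarrow> P x)"
    by eventually_elim auto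
  then show ?thesis by (simp add: AE_restrict_space_iff eventually_subst)
qed

lemma leb01_integral:
  fixes f :: "real \<Rightarrow> real"
  assumes "f \<in> borel_measurable leb01"
  shows "integrable leb01 f \<longleftrightarrow> integrable unit_leb f"
    and "(\<integral>x. f x \<partial>leb01) = (\<integral>x. f x \<partial>unit_leb)"
proof -
  have ae: "AE x in lebesgue. indicator {0..1} x *\<^sub>R f x = indicator {0<..<1} x *\<^sub>R f x"
    using AE_unit_endpoints by eventually_elim (auto simp: indicator_def)
  have m: "(\<lambda>x. indicator {0..1} x *\<^sub>R f x) \<in> borel_measurable lebesgue"
    "(\<lambda>x. indicator {0<..<1} x *\<^sub>R f x) \<in> borel_measurable lebesgue"
    using assms assms[unfolded leb01_measurable_iff] by (simp_all add: borel_measurable_restrict_space_iff)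
  show "integrable leb01 f \<longleftrightarrow> integrable unit_leb f"
    using integrable_cong_AE[OF m ae] by (simp add: integrable_restrict_space)
  show "(\<integral>x. f x \<partial>leb01) = (\<integral>x. f x \<partial>unit_leb)"
    using integral_cong_AE[OF m ae] by (simp add: integral_restrict_space)
qed

lemma Linfty_ebounded:
  assumes "f \<in> Linfty"
  shows "ebounded (norm_infty f) f"
proof -
  have m: "f \<in> borel_measurable leb01" and lt: "esssup leb01 (\<lambda>x. ereal \<bar>f x\<bar>) < \<infinity>"
    using assms by (auto simp: Linfty_def)
  have "AE x in leb01. ereal \<bar>f x\<bar> \<le> esssup leb01 (\<lambda>x. ereal \<bar>f x\<bar>)" by (rule esssup_AE)
  then have "AE x in leb01. \<bar>f x\<bar> \<le> norm_infty f"
  proof eventually_elim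
    case (elim x)
    then show ?case using lt unfolding norm_infty_def
      by (cases "esssup leb01 (\<lambda>x. ereal \<bar>f x\<bar>)") auto
  qed
  then show ?thesis using m by (simp add: ebounded_def leb01_measurable_iff AE_leb01_iff)
qed

lemma ebounded_nonneg:
  assumes "ebounded c f" shows "0 \<le> c"
proof (rule ccontr)
  assume c: "\<not> 0 \<le> c"
  have "AE x in unit_leb. \<bar>f x\<bar> \<le> c" using assms by (simp add: ebounded_def)
  then have "AE x in unit_leb. False" by eventually_elim (use c in auto)
  then have "emeasure unit_leb (space unit_leb) = 0" by (simp add: eventually_False ae_filter_eq_bot_iff)
  moreover have "measure unit_leb (space unit_leb) = 1" by simp
  ultimately show False by (simp add: measure_def)
qed

text \<open>\<open>norm_infty\<close> is an essential supremum, yet it bounds every value of a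
  continuous function on the open interval: the set where it is exceeded is open and null, hence
  empty. \<open>Lip\<close> is a supremum of reals, so it bounds the difference quotients once these
  are known to be bounded above.\<close>

lemma lipschitz_facts:
  assumes "is_lipschitz f"
  shows "f \<in> Linfty"
    and "\<And>x. 0 < x \<Longrightarrow> x < 1 \<Longrightarrow> \<bar>f x\<bar> \<le> norm_infty f"
    and "\<And>x y. 0 < x \<Longrightarrow> x \<le> y \<Longrightarrow> y < 1 \<Longrightarrow> \<bar>f y - f x\<bar> \<le> Lip f * (y - x)"
    and "0 \<le> Lip f"
proof -
  obtain L where L: "L-lipschitz_on {0..1} f" using assms by (auto simp: is_lipschitz_def)
  have cont: "continuous_on {0..1} f" by (rule lipschitz_on_continuous_on[OF L])
  have lip: "\<bar>f x - f y\<bar> \<le> L * \<bar>x - y\<bar>" if "x \<in> {0..1}" "y \<in> {0..1}" for x y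
    using lipschitz_onD[OF L that] by (simp add: dist_real_def)
  let ?S = "{\<bar>f x - f y\<bar> / \<bar>x - y\<bar> | x y. x \<in> {0..1} \<and> y \<in> {0..1} \<and> x \<noteq> y}"
  have bdd: "bdd_above ?S"
    using lip by (intro bdd_aboveI[of _ L]) (auto simp: pos_divide_le_eq)
  have up: "\<bar>f x - f y\<bar> / \<bar>x - y\<bar> \<le> Lip f" if "x \<in> {0..1}" "y \<in> {0..1}" "x \<noteq> y" for x y
    unfolding Lip_def using that by (intro cSup_upper[OF _ bdd]) blast
  have "0 \<le> \<bar>f 0 - f 1\<bar> / \<bar>0 - 1 :: real\<bar>" by simp
  also have "\<dots> \<le> Lip f" by (rule up) auto
  finally show "0 \<le> Lip f" .
  show "\<bar>f y - f x\<bar> \<le> Lip f * (y - x)" if "0 < x" "x \<le> y" "y < 1" for x y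
    using up[of y x] that by (cases "x = y") (auto simp: pos_divide_le_eq)
  have m: "f \<in> borel_measurable leb01" by (rule continuous_imp_measurable_on_sets_lebesgue[OF cont]) simp
  have "\<bar>f x\<bar> \<le> \<bar>f 0\<bar> + \<bar>L\<bar>" if "x \<in> {0..1}" for x
  proof -
    have "L * \<bar>x - 0\<bar> \<le> \<bar>L\<bar> * 1" using that by (intro mult_mono) auto
    then show ?thesis using lip[of x 0] that by auto
  qed
  then have "esssup leb01 (\<lambda>x. ereal \<bar>f x\<bar>) \<le> ereal (\<bar>f 0\<bar> + \<bar>L\<bar>)"
    using m by (intro esssup_I AE_I2) auto
  also have "\<dots> < \<infinity>" by simp
  finally show inf: "f \<in> Linfty" using m by (simp add: Linfty_def)
  show "\<bar>f x\<bar> \<le> norm_infty f" if x: "0 < x" "x < 1" for x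
  proof (rule ccontr)
    assume c: "\<not> ?thesis"
    let ?U = "{y \<in> {0<..<1}. norm_infty f < \<bar>f y\<bar>}"
    have "continuous_on {0<..<1} (\<lambda>y. \<bar>f y\<bar>)"
      by (intro continuous_intros continuous_on_subset[OF cont]) auto
    then have "open ({0<..<1} \<inter> (\<lambda>y. \<bar>f y\<bar>) -` {norm_infty f<..})"
      by (intro continuous_open_preimage) auto
    moreover have "?U = {0<..<1} \<inter> (\<lambda>y. \<bar>f y\<bar>) -` {norm_infty f<..}" by auto
    ultimately have op: "open ?U" by simp
    have "AE y in unit_leb. \<bar>f y\<bar> \<le> norm_infty f"
      using Linfty_ebounded[OF inf] by (simp add: ebounded_def)
    then have "AE y in lebesgue. y \<notin> ?U" by (auto simp: AE_restrict_space_iff not_less elim: eventually_mono)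
    then have "?U \<in> null_sets lebesgue"
      using op by (subst AE_iff_null_sets) auto
    then have "negligible ?U" by (simp add: negligible_iff_null_sets)
    moreover have "x \<in> ?U" using c x by simp
    ultimately show False using open_not_negligible[OF op] by auto
  qed
qed

text \<open>The probability condition fixes the mass to 1, so the integral disappears from the cone
  bound, and \<open>2 powr \<beta> * (2 + \<beta>) \<le> 6\<close> is below the larger pole
  constant.\<close>

lemma pm_cone_density:
  assumes b: "0 < \<beta>" "\<beta> < 1" and h: "h \<in> pm_cone \<beta>" and pr: "prob_space (density leb01 (\<lambda>x. ennreal (h x)))"
  shows "cone_density \<beta> h"
    and "\<And>f. f \<in> borel_measurable unit_leb \<Longrightarrow>
      (\<integral>x. f x \<partial>density leb01 (\<lambda>x. ennreal (h x))) = (\<integral>x. h x * f x \<partial>unit_leb)"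
proof -
  have i: "integrable leb01 h" and nn: "\<And>x. x \<in> {0<..1} \<Longrightarrow> 0 \<le> h x" and mono: "antimono_on {0<..1} h"
    and bd: "\<And>x. x \<in> {0<..1} \<Longrightarrow> h x \<le> 2 powr \<beta> * (2 + \<beta>) * x powr (- \<beta>) * (\<integral>y. h y \<partial>leb01)"
    using h by (auto simp: pm_cone_def)
  have m: "h \<in> borel_measurable leb01" using i by simp
  have ae: "AE x in leb01. 0 \<le> h x" unfolding AE_leb01_iff by (rule AE_I2) (auto intro: nn)
  show int: "(\<integral>x. f x \<partial>density leb01 (\<lambda>x. ennreal (h x))) = (\<integral>x. h x * f x \<partial>unit_leb)"
    if f: "f \<in> borel_measurable unit_leb" for f
  proof -
    have f': "f \<in> borel_measurable leb01" using f by (simp add: leb01_measurable_iff)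
    have "(\<integral>x. f x \<partial>density leb01 (\<lambda>x. ennreal (h x))) = (\<integral>x. h x * f x \<partial>leb01)"
      using integral_density[OF f' m ae] by simp
    also have "\<dots> = (\<integral>x. h x * f x \<partial>unit_leb)" using m f' by (intro leb01_integral) auto
    finally show ?thesis .
  qed
  have one: "(\<integral>x. h x \<partial>unit_leb) = 1"
    using int[of "\<lambda>_. 1"] prob_space.prob_space[OF pr] by simp
  then have one': "(\<integral>x. h x \<partial>leb01) = 1" using leb01_integral(2)[OF m] by simp
  have "h x \<le> 12 / (1 - \<beta>) * x powr (- \<beta>)" if x: "0 < x" "x < 1" for x
  proof -
    have "2 powr \<beta> * (2 + \<beta>) \<le> 2 powr 1 * 3" using b by (intro mult_mono powr_mono) auto
    also have "\<dots> \<le> 12 / (1 - \<beta>)" using b by (simp add: field_simps)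
    finally have "2 powr \<beta> * (2 + \<beta>) * x powr (- \<beta>) \<le> 12 / (1 - \<beta>) * x powr (- \<beta>)"
      by (intro mult_right_mono) auto
    then show ?thesis using bd[of x] one' x by simp
  qed
  moreover have "decr h" using nn mono by (intro decrI) (auto simp: monotone_on_def)
  moreover have "integrable unit_leb h" using i leb01_integral(1)[OF m] by simp
  ultimately show "cone_density \<beta> h" using one by (auto simp: cone_density_def)
qed

section \<open>The correlation bound\<close>

theorem corollary1p2:
  fixes \<beta> :: real
  assumes "0 < \<beta>" and "\<beta> < 1"
  shows "\<exists>C>0. \<forall>(\<alpha> :: nat \<Rightarrow> real) (l :: nat) (k :: nat) (f :: nat \<Rightarrow> real \<Rightarrow> real)
      (n :: nat \<Rightarrow> nat) (H :: real \<Rightarrow> real) (G :: real \<Rightarrow> real)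
      (h :: real \<Rightarrow> real) (\<mu> :: real measure).
      admissible \<beta> \<alpha> \<longrightarrow>
      l < k \<longrightarrow>
      (\<forall>i\<in>{0..l}. is_lipschitz (f i)) \<longrightarrow>
      (\<forall>i\<in>{l+1..k}. f i \<in> Linfty) \<longrightarrow>
      n 0 = 0 \<longrightarrow>
      (\<forall>i<k. n i \<le> n (i + 1)) \<longrightarrow>
      H = (\<lambda>x. \<Prod>i=0..l. f i (pm_iter \<alpha> (n i) x)) \<longrightarrow>
      G = (\<lambda>x. \<Prod>i=l+1..k. f i (pm_iter \<alpha> (n i) x)) \<longrightarrow>
      h \<in> pm_cone \<beta> \<longrightarrow>
      \<mu> = density leb01 (\<lambda>x. ennreal (h x)) \<longrightarrow>
      prob_space \<mu> \<longrightarrow>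
      \<bar>(\<integral>x. H x * G x \<partial>\<mu>) - (\<integral>x. H x \<partial>\<mu>) * (\<integral>x. G x \<partial>\<mu>)\<bar>
        \<le> C * (\<Prod>i=0..l. norm_Lip (f i)) * (\<Prod>i=l+1..k. norm_infty (f i))
            * rho \<beta> (n (l + 1) - n l)"
proof -
  obtain C where C: "0 < C" and loss: "\<And>\<alpha> F f g K N. pm_sequence \<beta> \<alpha> \<Longrightarrow> cone_density \<beta> F \<Longrightarrow>
      decr f \<Longrightarrow> decr g \<Longrightarrow> 0 \<le> K \<Longrightarrow>
      (\<forall>x. 0 < x \<longrightarrow> x < 1 \<longrightarrow> f x \<le> K * F x) \<Longrightarrow> (\<forall>x. 0 < x \<longrightarrow> x < 1 \<longrightarrow> g x \<le> K * F x) \<Longrightarrow>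
      (\<integral>x. f x \<partial>unit_leb) = (\<integral>x. g x \<partial>unit_leb) \<Longrightarrow>
      (\<integral>x. \<bar>transfer_iter \<alpha> N (\<lambda>x. f x - g x) x\<bar> \<partial>unit_leb) \<le> C * K * rho \<beta> N"
    using memory_loss[OF assms] by blast
  have "\<bar>(\<integral>x. H x * G x \<partial>\<mu>) - (\<integral>x. H x \<partial>\<mu>) * (\<integral>x. G x \<partial>\<mu>)\<bar>
        \<le> 3 * C * (\<Prod>i=0..l. norm_Lip (f i)) * (\<Prod>i=l+1..k. norm_infty (f i)) * rho \<beta> (n (l + 1) - n l)"
    if adm: "admissible \<beta> \<alpha>" and lk: "l < k" and lip: "\<forall>i\<in>{0..l}. is_lipschitz (f i)"
      and inf: "\<forall>i\<in>{l+1..k}. f i \<in> Linfty" and n0: "n 0 = 0" and nmono: "\<forall>i<k. n i \<le> n (i + 1)"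
      and H: "H = (\<lambda>x. \<Prod>i=0..l. f i (pm_iter \<alpha> (n i) x))"
      and G: "G = (\<lambda>x. \<Prod>i=l+1..k. f i (pm_iter \<alpha> (n i) x))"
      and h: "h \<in> pm_cone \<beta>" and \<mu>: "\<mu> = density leb01 (\<lambda>x. ennreal (h x))" and pr: "prob_space \<mu>"
    for \<alpha> :: "nat \<Rightarrow> real" and l k :: nat and f :: "nat \<Rightarrow> real \<Rightarrow> real" and n :: "nat \<Rightarrow> nat"
      and H G h :: "real \<Rightarrow> real" and \<mu> :: "real measure"
  proof -
    interpret pm_sequence \<beta> \<alpha> using assms adm by (simp add: pm_sequence_def)
    have cd: "cone_density \<beta> h" by (rule pm_cone_density(1)[OF assms h pr[unfolded \<mu>]])
    have hd: "decr h" and hi: "integrable unit_leb h" using cd by (auto simp: cone_density_def)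
    note int = pm_cone_density(2)[OF assms h pr[unfolded \<mu>], folded \<mu>]
    define F where "F = (\<lambda>i. transfer_iter \<alpha> (n i) h)"
    \<comment> \<open>The push-forward of \<open>h\<close> times the first factors to time
      \<open>n i\<close>, the time at which \<open>f i\<close> is evaluated, so that
      \<open>f i\<close> enters as a plain Lipschitz factor.\<close>
    define \<Phi> where "\<Phi> = (\<lambda>i. transfer_iter \<alpha> (n i) (\<lambda>x. h x * (\<Prod>j=0..i. f j (pm_iter \<alpha> (n j) x))))"
    have dom: "\<exists>a b. 0 \<le> a \<and> 0 \<le> b \<and> a + b \<le> (\<Prod>j=0..i. norm_Lip (f j)) \<and> lip_dominated a b (F i) (\<Phi> i)"
      if "i \<le> l" for i
      using that
    proof (induction i)
      case 0
      have "is_lipschitz (f 0)" using lip by simp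
      note fl = lipschitz_facts[OF this]
      have c0: "0 \<le> norm_infty (f 0)" by (rule ebounded_nonneg[OF Linfty_ebounded[OF fl(1)]])
      have "lip_dominated (1 * norm_infty (f 0)) (0 * norm_infty (f 0) + 1 * Lip (f 0)) h (\<lambda>x. h x * f 0 x)"
        by (rule lip_dominated_mult[OF lip_dominated_self[OF hd] fl(2,3)])
      then have "lip_dominated (norm_infty (f 0)) (Lip (f 0)) (F 0) (\<Phi> 0)"
        by (simp add: F_def \<Phi>_def n0)
      then show ?case using c0 fl(4)
        by - (rule exI[of _ "norm_infty (f 0)"], rule exI[of _ "Lip (f 0)"], simp add: norm_Lip_def)
    next
      case (Suc i)
      then obtain a b where ab: "0 \<le> a" "0 \<le> b" "a + b \<le> (\<Prod>j=0..i. norm_Lip (f j))"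
        "lip_dominated a b (F i) (\<Phi> i)" by auto
      let ?f = "f (Suc i)"
      have "is_lipschitz ?f" using lip Suc.prems by simp
      note fl = lipschitz_facts[OF this]
      have c0: "0 \<le> norm_infty ?f" by (rule ebounded_nonneg[OF Linfty_ebounded[OF fl(1)]])
      have nle: "n i \<le> n (Suc i)" using nmono Suc.prems lk by simp
      define d where "d = n (Suc i) - n i"
      have nS: "n (Suc i) = n i + d" using nle by (simp add: d_def)
      have Fd: "decr (F i)" "decr (F (Suc i))" unfolding F_def using hd by (auto intro: iter_decr)
      have FS: "F (Suc i) = transfer_iter (shift (n i) \<alpha>) d (F i)"
        unfolding F_def nS by (rule transfer_iter_add)
      have PS: "\<Phi> (Suc i) x = transfer_iter (shift (n i) \<alpha>) d (\<Phi> i) x * ?f x" if "0 < x" "x < 1" for x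
      proof -
        have "\<Phi> (Suc i) x = transfer_iter \<alpha> (n (Suc i))
            (\<lambda>x. (h x * (\<Prod>j=0..i. f j (pm_iter \<alpha> (n j) x))) * ?f (pm_iter \<alpha> (n (Suc i)) x)) x"
          unfolding \<Phi>_def by (simp add: mult.assoc)
        also have "\<dots> = transfer_iter \<alpha> (n (Suc i)) (\<lambda>x. h x * (\<Prod>j=0..i. f j (pm_iter \<alpha> (n j) x))) x * ?f x"
          by (rule iter_mult[OF that])
        also have "transfer_iter \<alpha> (n (Suc i)) (\<lambda>x. h x * (\<Prod>j=0..i. f j (pm_iter \<alpha> (n j) x)))
            = transfer_iter (shift (n i) \<alpha>) d (\<Phi> i)"
          unfolding \<Phi>_def nS by (rule transfer_iter_add)
        finally show ?thesis .
      qed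
      have "lip_dominated a b (F (Suc i)) (transfer_iter (shift (n i) \<alpha>) d (\<Phi> i))"
        unfolding FS using ab Fd by (intro pm_sequence.lip_dominated_iter[OF shift_pm]) auto
      then have "lip_dominated (a * norm_infty ?f) (b * norm_infty ?f + a * Lip ?f) (F (Suc i))
          (\<lambda>x. transfer_iter (shift (n i) \<alpha>) d (\<Phi> i) x * ?f x)"
        by (intro lip_dominated_mult fl)
      then have "lip_dominated (a * norm_infty ?f) (b * norm_infty ?f + a * Lip ?f) (F (Suc i)) (\<Phi> (Suc i))"
        by (rule lip_dominated_cong[rotated 2]) (simp_all add: PS)
      moreover have "a * norm_infty ?f + (b * norm_infty ?f + a * Lip ?f) \<le> (\<Prod>j=0..Suc i. norm_Lip (f j))"
      proof -
        have "a * norm_infty ?f + (b * norm_infty ?f + a * Lip ?f) \<le> (a + b) * norm_Lip ?f"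
          using ab fl(4) by (simp add: norm_Lip_def algebra_simps)
        also have "\<dots> \<le> (\<Prod>j=0..i. norm_Lip (f j)) * norm_Lip ?f"
          using ab(3) c0 fl(4) by (intro mult_right_mono) (auto simp: norm_Lip_def)
        finally show ?thesis by simp
      qed
      ultimately show ?case using ab c0 fl(4)
        by - (rule exI[of _ "a * norm_infty ?f"], rule exI[of _ "b * norm_infty ?f + a * Lip ?f"], simp)
    qed
    obtain a b where ab: "0 \<le> a" "0 \<le> b" "a + b \<le> (\<Prod>j=0..l. norm_Lip (f j))"
      "lip_dominated a b (F l) (\<Phi> l)" using dom[of l] by auto
    have Fl: "cone_density \<beta> (F l)" unfolding F_def by (rule iter_cone_density[OF cd])
    \<comment> \<open>This is the integral of \<open>H\<close> with respect to \<mu>, by fact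
      \<open>2\<close> below.\<close>
    define c where "c = (\<integral>x. \<Phi> l x \<partial>unit_leb)"
    obtain p q where pq: "decr p" "decr q" "\<forall>x. 0 < x \<longrightarrow> x < 1 \<longrightarrow> p x \<le> 3 * (a + b) * F l x"
      "\<forall>x. 0 < x \<longrightarrow> x < 1 \<longrightarrow> q x \<le> 3 * (a + b) * F l x"
      "(\<integral>x. p x \<partial>unit_leb) = (\<integral>x. q x \<partial>unit_leb)"
      "(\<lambda>x. \<Phi> l x - c * F l x) = (\<lambda>x. p x - q x)" and \<Phi>i: "integrable unit_leb (\<Phi> l)"
      using lip_dominated_split[OF Fl ab(1,2,4)] unfolding c_def by blast
    define N d \<alpha>' where "N = n (l + 1)" and "d = n (l + 1) - n l" and "\<alpha>' = shift (n l) \<alpha>"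
    have Nd: "N = n l + d" using nmono lk by (simp add: N_def d_def)
    interpret s: pm_sequence \<beta> \<alpha>' unfolding \<alpha>'_def by (rule shift_pm)
    \<comment> \<open>Memory is lost over the \<open>d\<close> steps between the last observation in
      \<open>H\<close> and the first one in \<open>G\<close>.\<close>
    have loss': "(\<integral>x. \<bar>transfer_iter \<alpha>' d (\<lambda>x. \<Phi> l x - c * F l x) x\<bar> \<partial>unit_leb) \<le> C * (3 * (a + b)) * rho \<beta> d"
      unfolding pq(6) using pq ab(1,2) by (intro loss[OF s.pm_sequence_axioms Fl]) auto
    have nN: "N \<le> n i" if "i \<in> {l+1..k}" for i
    proof -
      have "l + 1 \<le> i" "i \<le> k" using that by auto
      then show ?thesis unfolding N_def
        by (induction i rule: dec_induct) (use nmono in \<open>auto intro: order.trans\<close>)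
    qed
    \<comment> \<open>All factors of \<open>G\<close> are observed at time \<open>N\<close> or
      later, so \<open>G\<close> depends only on the state at time \<open>N\<close>.\<close>
    define G' where "G' = (\<lambda>x. \<Prod>i=l+1..k. f i (pm_iter (shift N \<alpha>) (n i - N) x))"
    have GG': "G = (\<lambda>x. G' (pm_iter \<alpha> N x))"
      unfolding G G'_def using nN by (auto intro!: prod.cong simp: fun_eq_iff pm_iter_add[symmetric])
    let ?P = "\<Prod>i=l+1..k. norm_infty (f i)"
    have eG': "ebounded ?P G'"
      unfolding G'_def using inf
      by (intro ebounded_prod pm_sequence.ebounded_iter[OF shift_pm] Linfty_ebounded) auto
    have eG: "ebounded ?P G" unfolding GG' by (rule ebounded_iter[OF eG'])
    have eH: "ebounded (\<Prod>i=0..l. norm_infty (f i)) H"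
      unfolding H using lip by (intro ebounded_prod ebounded_iter Linfty_ebounded lipschitz_facts(1)) auto
    have mH: "H \<in> borel_measurable unit_leb" and mG: "G \<in> borel_measurable unit_leb"
      using eH eG by (auto simp: ebounded_def)
    have ihH: "integrable unit_leb (\<lambda>x. h x * H x)" by (rule ebounded_integrable_mult[OF eH hi])
    have ihG: "integrable unit_leb (\<lambda>x. h x * G x)" by (rule ebounded_integrable_mult[OF eG hi])
    have ihHG: "integrable unit_leb (\<lambda>x. (h x * H x) * G x)" by (rule ebounded_integrable_mult[OF eG ihH])
    have \<Phi>H: "transfer_iter \<alpha> N (\<lambda>x. h x * H x) = transfer_iter \<alpha>' d (\<Phi> l)"
      unfolding Nd \<Phi>_def \<alpha>'_def H by (rule transfer_iter_add)
    have Fh: "transfer_iter \<alpha> N h = transfer_iter \<alpha>' d (F l)"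
      unfolding Nd F_def \<alpha>'_def by (rule transfer_iter_add)
    have Fi: "integrable unit_leb (F l)" using Fl by (simp add: cone_density_def)
    have iT: "integrable unit_leb (\<lambda>x. transfer_iter \<alpha>' d (\<Phi> l) x * G' x)"
      "integrable unit_leb (\<lambda>x. transfer_iter \<alpha>' d (F l) x * G' x)"
      by (intro ebounded_integrable_mult[OF eG'] s.iter_integral \<Phi>i Fi)+
    have 1: "(\<integral>x. H x * G x \<partial>\<mu>) = (\<integral>x. transfer_iter \<alpha>' d (\<Phi> l) x * G' x \<partial>unit_leb)"
    proof -
      have "(\<integral>x. H x * G x \<partial>\<mu>) = (\<integral>x. (h x * H x) * G x \<partial>unit_leb)"
        using int[of "\<lambda>x. H x * G x"] mH mG by (simp add: mult.assoc)
      also have "\<dots> = (\<integral>x. transfer_iter \<alpha> N (\<lambda>x. h x * H x) x * G' x \<partial>unit_leb)"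
        using iter_dual[of "\<lambda>x. h x * H x" G' N] ihHG by (simp add: GG')
      finally show ?thesis by (simp only: \<Phi>H)
    qed
    have 2: "(\<integral>x. H x \<partial>\<mu>) = c"
      using int[OF mH] iter_integral(2)[OF ihH, of "n l"] by (simp add: c_def \<Phi>_def H)
    have 3: "(\<integral>x. G x \<partial>\<mu>) = (\<integral>x. transfer_iter \<alpha>' d (F l) x * G' x \<partial>unit_leb)"
      using int[OF mG] iter_dual[of h G' N] ihG by (simp add: GG' Fh)
    \<comment> \<open>The product of the integrals pairs \<open>G'\<close> with \<open>c\<close>
      times the transported density, so the covariance pairs \<open>G'\<close> with a transported
      function of integral 0.\<close>
    have "(\<integral>x. H x * G x \<partial>\<mu>) - (\<integral>x. H x \<partial>\<mu>) * (\<integral>x. G x \<partial>\<mu>)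
        = (\<integral>x. transfer_iter \<alpha>' d (\<Phi> l) x * G' x - c * (transfer_iter \<alpha>' d (F l) x * G' x) \<partial>unit_leb)"
      unfolding 1 2 3 using iT by simp
    also have "\<dots> = (\<integral>x. transfer_iter \<alpha>' d (\<lambda>x. \<Phi> l x - c * F l x) x * G' x \<partial>unit_leb)"
      unfolding transfer_iter_linear by (simp add: algebra_simps)
    finally have "\<bar>(\<integral>x. H x * G x \<partial>\<mu>) - (\<integral>x. H x \<partial>\<mu>) * (\<integral>x. G x \<partial>\<mu>)\<bar>
        \<le> ?P * (\<integral>x. \<bar>transfer_iter \<alpha>' d (\<lambda>x. \<Phi> l x - c * F l x) x\<bar> \<partial>unit_leb)"
      using ebounded_integral_le[OF eG' s.iter_integral(1)[of "\<lambda>x. \<Phi> l x - c * F l x" d]] \<Phi>i Fi by simp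
    also have "\<dots> \<le> ?P * (C * (3 * (\<Prod>j=0..l. norm_Lip (f j))) * rho \<beta> d)"
    proof (rule mult_left_mono)
      have "C * (3 * (a + b)) * rho \<beta> d \<le> C * (3 * (\<Prod>j=0..l. norm_Lip (f j))) * rho \<beta> d"
        using ab(3) C rho_nonneg by (intro mult_right_mono mult_left_mono) auto
      then show "(\<integral>x. \<bar>transfer_iter \<alpha>' d (\<lambda>x. \<Phi> l x - c * F l x) x\<bar> \<partial>unit_leb)
          \<le> C * (3 * (\<Prod>j=0..l. norm_Lip (f j))) * rho \<beta> d" using loss' by linarith
      show "0 \<le> ?P" using ebounded_nonneg[OF eG'] .
    qed
    finally show ?thesis by (simp add: d_def mult_ac)
  qed
  \<comment> \<open>The 3 is the domination constant of \<open>lip_dominated_split\<close>.\<close>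
  then show ?thesis using C by (intro exI[of _ "3 * C"]) auto
qed

end
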